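(* Let $f:\mathbb{R}^n\times\Theta\to\mathbb{R}$ satisfy (A.1)–(A.3) and assume in addition that $f$ is strongly convex with respect to $x$ (for each $\theta\in\Theta$). For $\theta\in\Theta$, let $x^\star(\theta)$ be the unique minimizer of $f(\cdot,\theta)$ and $X^\star(\theta)=(x^\star(\theta),x^\star(\theta))\in\mathbb{R}^{2n}$. Let $(X_k(\theta))_{k\in\mathbb{N}}$, $X_k(\theta)=(x_k(\theta),x_{k-1}(\theta))$, be generated by the inertial method described in the context, whose parameters satisfy conditions (B), (C.1) and (C.2), with limits $a,b,\gamma$ as in (C.1). Assume that $X_0:\Theta\to\mathbb{R}^{2n}$ is continuously differentiable with respect to $\theta$. Then: 1. the sequence of derivatives $(\partial_\theta X_k(\theta))_{k\in\mathbb{N}}$ converges pointwise (in $\theta\in\Theta$) to the derivative $\partial_\theta X^\star(\theta)$; 2. moreover, for all $\theta\in\Theta$, $$\partial_\theta X^\star(\theta)=\begin{pmatrix}-a\,\mathrm{Id}+\gamma(1+b)\nabla_x^2f(x^\star(\theta),\theta)&a\,\mathrm{Id}-\gamma b\nabla_x^2f(x^\star(\theta),\theta)\\-\mathrm{Id}&\mathrm{Id}\end{pmatrix}^{-1}\begin{pmatrix}-\gamma\nabla_{x\theta}^2f(x^\star(\theta),\theta)\\0\end{pmatrix}.$$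
   Context: $\Theta\subseteq\mathbb{R}^m$ is open. The problem is $\min_{x\in\mathbb{R}^n}f(x,\theta)$ for $\theta\in\Theta$. $\partial_\theta$ denotes the Jacobian with respect to $\theta$ (so $\partial_\theta X_k(\theta)\in\mathbb{R}^{2n\times m}$); $\nabla_x^2f$ is the Hessian in $x$ and $\nabla_{x\theta}^2f$ is the $n\times m$ Jacobian of $\nabla_xf$ with respect to $\theta$. Conditions on $f$: (A.1) $f$ is $C^2$-smooth with respect to both $x,\theta$; (A.2) $\nabla_xf$ is $L$-Lipschitz continuous in both $x,\theta$; (A.3) for all $\theta\in\Theta$, $x\mapsto f(x,\theta)$ is level bounded (all sublevel sets are bounded). Inertial method: with $a_k\in[0,\bar a]$, $\bar a\le1$, $b_k\in[0,\bar b]$, $\bar b\le1$, $0<\gamma_k<2/L$, and $x_{-1}=x_0$ (so $X_0=(x_0,x_0)$, which may depend on $\theta$), for $k=0,1,\dots$ $$y_{a_k}=x_k+a_k(x_k-x_{k-1}),\quad y_{b_k}=x_k+b_k(x_k-x_{k-1}),\quad x_{k+1}=y_{a_k}-\gamma_k\nabla_xf(y_{b_k},\theta).$$ (B) There exists a constant $\tau>0$ such that one of the following holds: - for all $k\in\mathbb{N}$, $\tau<(1+a_k)-\frac{\gamma_kL}{2}(1+b_k)^2$, with $a_k<\frac{\gamma_kL}{2}b_k$; - for all $k\in\mathbb{N}$, $\tau<(1-3a_k)-\frac{\gamma_kL}{2}(1-b_k)^2$, with $b_k\le a_k$ or $\frac{\gamma_kL}{2}b_k\le a_k<b_k$. (C.1)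 There exist $a,b\in[0,1]$ and $\gamma\in(0,\frac2L)$ such that $a_k\to a$, $b_k\to b$ and $\gamma_k\to\gamma$. (C.2) Given any limit points $a,b$ of $(a_k),(b_k)$ respectively, with $(a,b)\in[0,1)^2$, one has $\frac{2(b-a)-1}{1+2b}<\underline{\eta}_\theta$, where $\underline{\eta}_\theta$ is the smallest eigenvalue of $G_\theta=\mathrm{Id}-\gamma\nabla_x^2f(x^\star(\theta),\theta)$. *)

theory Defs
  imports "HOL-Analysis.Analysis"
begin

(* Both smoothness predicates are meant for open S. *)

definition C1_on :: "'a::real_normed_vector set \<Rightarrow> ('a \<Rightarrow> 'b::real_normed_vector) \<Rightarrow> bool" where
  "C1_on S g \<longleftrightarrow>
    (\<exists>g' :: 'a \<Rightarrow> ('a \<Rightarrow>\<^sub>L 'b).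
      (\<forall>z\<in>S. (g has_derivative blinfun_apply (g' z)) (at z)) \<and> continuous_on S g')"

definition C2_on :: "'a::real_normed_vector set \<Rightarrow> ('a \<Rightarrow> 'b::real_normed_vector) \<Rightarrow> bool" where
  "C2_on S g \<longleftrightarrow>
    (\<exists>g' :: 'a \<Rightarrow> ('a \<Rightarrow>\<^sub>L 'b).
      (\<forall>z\<in>S. (g has_derivative blinfun_apply (g' z)) (at z)) \<and> C1_on S g')"

definition grad :: "('a::real_inner \<Rightarrow> real) \<Rightarrow> 'a \<Rightarrow> 'a" where
  "grad g x = (THE D. GDERIV g x :> D)"

definition grad_x :: "('a::real_inner \<Rightarrow> 'b \<Rightarrow> real) \<Rightarrow> 'a \<Rightarrow> 'b \<Rightarrow> 'a" where
  "grad_x f x \<theta> = grad (\<lambda>u. f u \<theta>) x"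

definition hess_xx :: "(real^'n \<Rightarrow> 'b \<Rightarrow> real) \<Rightarrow> real^'n \<Rightarrow> 'b \<Rightarrow> real^'n^'n" where
  "hess_xx f x \<theta> = jacobian (\<lambda>u. grad_x f u \<theta>) (at x)"

definition hess_xt :: "(real^'n \<Rightarrow> real^'m \<Rightarrow> real) \<Rightarrow> real^'n \<Rightarrow> real^'m \<Rightarrow> real^'m^'n" where
  "hess_xt f x \<theta> = jacobian (\<lambda>t. grad_x f x t) (at \<theta>)"

definition level_bounded :: "('a::metric_space \<Rightarrow> real) \<Rightarrow> bool" where
  "level_bounded g \<longleftrightarrow> (\<forall>c. bounded {x. g x \<le> c})"

definition strongly_convex :: "('a::real_normed_vector \<Rightarrow> real) \<Rightarrow> bool" where
  "strongly_convex g \<longleftrightarrow>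
    (\<exists>\<mu>>0. \<forall>x y. \<forall>t\<in>{0..1}.
      g ((1 - t) *\<^sub>R x + t *\<^sub>R y)
        \<le> (1 - t) * g x + t * g y - \<mu> / 2 * t * (1 - t) * (norm (x - y))\<^sup>2)"

definition the_minimizer :: "('a \<Rightarrow> real) \<Rightarrow> 'a" where
  "the_minimizer g = (THE x. is_arg_min g (\<lambda>_. True) x)"

(* Stacking (u, v) into one column.  The entries may be scalars (vectors in R^(p+q)) or
   rows (matrices placed one above the other). *)
definition stack :: "'a^'p \<Rightarrow> 'a^'q \<Rightarrow> 'a^('p + 'q)" where
  "stack u v = (\<chi> i. case i of Inl k \<Rightarrow> u $ k | Inr k \<Rightarrow> v $ k)"

definition block_matrix ::
  "'a^'p^'r \<Rightarrow> 'a^'q^'r \<Rightarrow> 'a^'p^'s \<Rightarrow> 'a^'q^'s \<Rightarrow> 'a^('p + 'q)^('r + 's)" where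
  "block_matrix A B C D = stack (\<chi> i. stack (A $ i) (B $ i)) (\<chi> i. stack (C $ i) (D $ i))"

definition eigenvalue_of :: "real^'n^'n \<Rightarrow> real \<Rightarrow> bool" where
  "eigenvalue_of A l \<longleftrightarrow> (\<exists>v. v \<noteq> 0 \<and> A *v v = l *\<^sub>R v)"

(* Only real eigenvalues are considered; for a symmetric A these are all of them, and there
   is at least one. *)
definition smallest_eigenvalue :: "real^'n^'n \<Rightarrow> real" where
  "smallest_eigenvalue A = Min {l. eigenvalue_of A l}"

(* Limit points of a sequence, i.e. limits of subsequences; this is not the same as
   islimpt of the range, which misses values attained infinitely often. *)
definition seq_limit_point :: "(nat \<Rightarrow> real) \<Rightarrow> real \<Rightarrow> bool" where
  "seq_limit_point s l \<longleftrightarrow> (\<exists>r. strict_mono (r :: nat \<Rightarrow> nat) \<and> (s \<circ> r) \<longlonglongrightarrow> l)"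

(* The convention x_{-1} = x_0 is encoded by truncated subtraction: for k = 0,
   u (k - 1) is u 0. *)
definition inertial_iteration ::
  "('a::real_vector \<Rightarrow> 'a) \<Rightarrow> (nat \<Rightarrow> real) \<Rightarrow> (nat \<Rightarrow> real) \<Rightarrow> (nat \<Rightarrow> real) \<Rightarrow> (nat \<Rightarrow> 'a) \<Rightarrow> bool"
where
  "inertial_iteration G a b \<gamma> u \<longleftrightarrow>
    (\<forall>k. let ya = u k + a k *\<^sub>R (u k - u (k - 1));
             yb = u k + b k *\<^sub>R (u k - u (k - 1))
         in u (Suc k) = ya - \<gamma> k *\<^sub>R G yb)"

definition condition_B ::
  "real \<Rightarrow> (nat \<Rightarrow> real) \<Rightarrow> (nat \<Rightarrow> real) \<Rightarrow> (nat \<Rightarrow> real) \<Rightarrow> bool" where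
  "condition_B L a b \<gamma> \<longleftrightarrow>
    (\<exists>\<tau>>0.
      (\<forall>k. \<tau> < (1 + a k) - \<gamma> k * L / 2 * (1 + b k)\<^sup>2 \<and> a k < \<gamma> k * L / 2 * b k) \<or>
      (\<forall>k. \<tau> < (1 - 3 * a k) - \<gamma> k * L / 2 * (1 - b k)\<^sup>2 \<and>
           (b k \<le> a k \<or> (\<gamma> k * L / 2 * b k \<le> a k \<and> a k < b k))))"

(* eta stands for the smallest eigenvalue of G_theta. *)
definition condition_C2 :: "(nat \<Rightarrow> real) \<Rightarrow> (nat \<Rightarrow> real) \<Rightarrow> real \<Rightarrow> bool" where
  "condition_C2 a b \<eta> \<longleftrightarrow>
    (\<forall>a' b'. seq_limit_point a a' \<and> seq_limit_point b b' \<and> (a', b') \<in> {0..<1} \<times> {0..<1} \<longrightarrow>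
       (2 * (b' - a') - 1) / (1 + 2 * b') < \<eta>)"

end

theory Submission
  imports Defs
begin

text \<open>
  Fix a parameter \<open>\<theta>\<close>. Three facts combine.

  First, the iterates converge to the minimizer. The function value plus a multiple of the squared
  last increment is a Lyapunov function, and the step condition \<^const>\<open>condition_B\<close> together
  with the convergence of the parameters makes it decrease eventually (\<open>inertial_iterates_converge\<close>).

  Second, the minimizer is differentiable. It is the zero of the gradient field, which is continuously
  differentiable, strongly monotone in \<open>x\<close> and Lipschitz in \<open>\<theta>\<close>; this already gives the derivative
  \<open>S\<close> with \<open>H S = - J\<close>, where \<open>H\<close> and \<open>J\<close> are the second derivatives at the minimizer
  (\<open>parametrized_zero_has_derivative\<close>).

  Third, differentiating the iteration gives a linear recursion for the derivatives of the iterates.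
  Because the iterates converge, its coefficients converge, and \<open>S\<close> is the fixed point of the limiting
  recursion. Derivatives therefore converge to \<open>S\<close> as soon as the limiting recursion is stable
  (\<open>linearized_inertial_iteration_converges\<close>). The limiting recursion is
  \<open>z\<^sub>k\<^sub>+\<^sub>1 = T z\<^sub>k - D z\<^sub>k\<^sub>-\<^sub>1\<close> where \<open>T\<close> and \<open>D\<close> are affine functions of the symmetric matrix \<open>H\<close>.
  Instead of computing the spectral radius of its companion matrix, the proof uses the Schur--Cohn
  quadratic form, a Lyapunov function whose positivity and decrease are the three classical
  conditions \<open>1 + D - T > 0\<close>, \<open>1 + D + T > 0\<close>, \<open>1 - D > 0\<close>
  (\<open>two_term_recursion_power_halves\<close>). The first follows from strong convexity, the last from
  \<open>a < 1\<close>, and the middle one is the eigenvalue condition \<^const>\<open>condition_C2\<close>, turned into a statement about quadratic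
  forms by the Rayleigh principle (\<open>smallest_eigenvalue_le_rayleigh\<close>). That condition is void when a
  limit parameter equals \<open>1\<close>; there the step condition takes over (\<open>condition_B_limits\<close>).

  The matrix formula is the fixed point equation of the limiting recursion, written for the pair of two
  consecutive iterates.
\<close>

section \<open>Asymptotically linear recursions\<close>

text \<open>
  Once the perturbation is small, the recursion is a contraction with a factor strictly between
  \<open>\<rho>\<close> and \<open>1\<close> plus an additive error that tends to zero, so any level \<open>r / 2\<close> eventually
  absorbs the additive error and the rest decays geometrically.
\<close>
lemma tendsto_zero_of_perturbed_contraction:
  fixes u \<epsilon> :: "nat \<Rightarrow> real"
  assumes nonneg: "\<And>k. 0 \<le> u k"
    and rho: "0 \<le> \<rho>" "\<rho> < 1"
    and eps: "\<epsilon> \<longlonglongrightarrow> 0"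
    and step: "\<And>k. u (Suc k) \<le> \<rho> * u k + \<epsilon> k * (u k + 1)"
  shows "u \<longlonglongrightarrow> 0"
proof (rule LIMSEQ_I)
  fix r :: real assume r: "0 < r"
  \<comment> \<open>Half of the gap between the contraction factor and 1 absorbs the multiplicative error.\<close>
  define q where "q = (1 + \<rho>) / 2"
  have q: "0 \<le> q" "q < 1" using rho by (auto simp: q_def)
  define d where "d = min ((1 - \<rho>) / 2) ((1 - q) * (r / 2))"
  have "0 < d" using rho q r by (simp add: d_def)
  from order_tendstoD(2)[OF eps this] obtain K where K: "\<And>k. K \<le> k \<Longrightarrow> \<epsilon> k < d"
    by (auto simp: eventually_sequentially)
  have step': "u (Suc k) \<le> q * u k + (1 - q) * (r / 2)" if "K \<le> k" for k
  proof -
    have "\<epsilon> k * u k \<le> (1 - \<rho>) / 2 * u k"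
      using K[OF that] nonneg[of k] by (intro mult_right_mono) (auto simp: d_def)
    then have "\<rho> * u k + \<epsilon> k * (u k + 1) \<le> q * u k + \<epsilon> k"
      by (simp add: q_def field_simps)
    then show ?thesis using step[of k] K[OF that] by (simp add: d_def)
  qed
  have bound: "u (K + j) \<le> q ^ j * u K + r / 2" for j
  proof (induction j)
    case (Suc j)
    have "u (K + Suc j) \<le> q * u (K + j) + (1 - q) * (r / 2)" using step'[of "K + j"] by simp
    also have "\<dots> \<le> q * (q ^ j * u K + r / 2) + (1 - q) * (r / 2)"
      using Suc q by (intro add_right_mono mult_left_mono)
    also have "\<dots> = q ^ Suc j * u K + r / 2" by (simp add: field_simps)
    finally show ?case .
  qed (use r in simp)
  have "(\<lambda>j. q ^ j * u K + r / 2) \<longlonglongrightarrow> 0 * u K + r / 2"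
    using q by (intro tendsto_intros LIMSEQ_realpow_zero)
  from order_tendstoD(2)[OF this, of r]
  have "eventually (\<lambda>j. q ^ j * u K + r / 2 < r) sequentially" using r by simp
  then obtain N where "\<And>j. N \<le> j \<Longrightarrow> q ^ j * u K + r / 2 < r"
    by (auto simp: eventually_sequentially)
  then have "u (K + j) < r" if "N \<le> j" for j using bound[of j] that by fastforce
  then have "norm (u k - 0) < r" if "K + N \<le> k" for k
    using that nonneg[of k] le_Suc_ex[of K k]
    by (metis abs_of_nonneg add_le_cancel_left add_leD1 diff_zero le_Suc_ex real_norm_def)
  then show "\<exists>no. \<forall>k\<ge>no. norm (u k - 0) < r" by blast
qed

text \<open>
  If the power \<open>A ^ m\<close> halves norms, then \<open>A\<close> itself contracts the equivalent norm
  \<open>N z = (\<Sum>i<m. r ^ i * norm (A ^ i z))\<close> with \<open>r ^ m = 2\<close>: applying \<open>A\<close> shifts the sum by one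
  position, which costs the factor \<open>1 / r\<close>, and the term that enters at the top is paid for by the
  term that leaves at the bottom. In this norm the perturbation argument needs only one step at a
  time. The error bound \<open>\<epsilon> k * (norm (e k) + 1)\<close> covers both coefficients and inhomogeneities that
  merely converge.
\<close>
lemma tendsto_zero_of_perturbed_linear_recursion:
  fixes A :: "'a::real_normed_vector \<Rightarrow> 'a" and e :: "nat \<Rightarrow> 'a"
  assumes A: "bounded_linear A" and m: "0 < m"
    and halves: "\<And>z. norm ((A ^^ m) z) \<le> norm z / 2"
    and eps: "\<epsilon> \<longlonglongrightarrow> 0"
    and step: "\<And>k. norm (e (Suc k) - A (e k)) \<le> \<epsilon> k * (norm (e k) + 1)"
  shows "e \<longlonglongrightarrow> 0"
proof -
  define r where "r = root m 2"
  have r: "1 < r" "r ^ m = 2" using m by (auto simp: r_def real_root_pow_pos2)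
  define N where "N z = (\<Sum>i<m. r ^ i * norm ((A ^^ i) z))" for z
  have blin: "bounded_linear (A ^^ i)" for i
  proof (induction i)
    case 0 then show ?case by (simp add: id_def bounded_linear_ident)
  next
    case (Suc i) then show ?case using bounded_linear_compose[OF A] by (simp add: o_def)
  qed
  have N_tri: "N (y + z) \<le> N y + N z" for y z
  proof -
    have "N (y + z) \<le> (\<Sum>i<m. r ^ i * norm ((A ^^ i) y) + r ^ i * norm ((A ^^ i) z))"
      unfolding N_def
    proof (rule sum_mono)
      fix i
      have "norm ((A ^^ i) (y + z)) \<le> norm ((A ^^ i) y) + norm ((A ^^ i) z)"
        using bounded_linear.linear[OF blin] by (simp add: linear_add norm_triangle_ineq)
      then show "r ^ i * norm ((A ^^ i) (y + z))
          \<le> r ^ i * norm ((A ^^ i) y) + r ^ i * norm ((A ^^ i) z)"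
        using r mult_left_mono[of _ _ "r ^ i"] by (fastforce simp: algebra_simps)
    qed
    then show ?thesis by (simp add: N_def sum.distrib)
  qed
  have N_lower: "norm z \<le> N z" for z
  proof -
    have "norm z = (\<Sum>i\<in>{0}. r ^ i * norm ((A ^^ i) z))" by simp
    also have "\<dots> \<le> N z" unfolding N_def using m r by (intro sum_mono2) auto
    finally show ?thesis .
  qed
  define C where "C = (\<Sum>i<m. r ^ i * onorm (A ^^ i))"
  have C: "0 \<le> C" using r blin by (auto simp: C_def onorm_pos_le intro!: sum_nonneg)
  have N_upper: "N z \<le> C * norm z" for z
    unfolding N_def C_def sum_distrib_right
  proof (rule sum_mono)
    fix i
    show "r ^ i * norm ((A ^^ i) z) \<le> r ^ i * onorm (A ^^ i) * norm z"
      using onorm[OF blin, of i z] r by (simp add: mult.assoc mult_left_mono)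
  qed
  have N_contract: "N (A z) \<le> inverse r * N z" for z
  proof -
    have "r * N (A z) = (\<Sum>i<m. r ^ Suc i * norm ((A ^^ Suc i) z))"
      unfolding N_def sum_distrib_left by (simp add: funpow_swap1 mult.assoc)
    also have "\<dots> = (\<Sum>i<Suc m. r ^ i * norm ((A ^^ i) z)) - norm z"
      by (subst sum.lessThan_Suc_shift) simp
    also have "\<dots> = N z + r ^ m * norm ((A ^^ m) z) - norm z" by (simp add: N_def)
    also have "\<dots> \<le> N z" using halves[of z] r(2) by simp
    finally show ?thesis using r by (simp add: field_simps)
  qed
  have "(\<lambda>k. N (e k)) \<longlonglongrightarrow> 0"
  proof (rule tendsto_zero_of_perturbed_contraction)
    show "0 \<le> N (e k)" for k using N_lower[of "e k"] norm_ge_zero order_trans by blast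
    show "0 \<le> inverse r" "inverse r < 1" using r by (auto simp: field_simps)
    show "(\<lambda>k. C * \<bar>\<epsilon> k\<bar>) \<longlonglongrightarrow> 0"
      using tendsto_mult[OF tendsto_const tendsto_rabs[OF eps], of C] by simp
    fix k
    have "N (e (Suc k)) \<le> N (A (e k)) + N (e (Suc k) - A (e k))"
      using N_tri[of "A (e k)" "e (Suc k) - A (e k)"] by simp
    also have "N (e (Suc k) - A (e k)) \<le> C * (\<bar>\<epsilon> k\<bar> * (N (e k) + 1))"
    proof -
      have "norm (e (Suc k) - A (e k)) \<le> \<epsilon> k * (norm (e k) + 1)" by (rule step)
      also have "\<dots> \<le> \<bar>\<epsilon> k\<bar> * (N (e k) + 1)"
        using N_lower[of "e k"] by (intro mult_mono) auto
      finally show ?thesis using N_upper C mult_left_mono order_trans by blast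
    qed
    finally show "N (e (Suc k)) \<le> inverse r * N (e k) + C * \<bar>\<epsilon> k\<bar> * (N (e k) + 1)"
      using N_contract[of "e k"] by (simp add: mult.assoc)
  qed
  then have "(\<lambda>k. norm (e k)) \<longlonglongrightarrow> 0"
    by (rule real_tendsto_sandwich[rotated 3, where f = "\<lambda>_. 0"]) (use N_lower in auto)
  then show ?thesis by (rule tendsto_norm_zero_cancel)
qed

section \<open>Stability of symmetric two-term recursions\<close>

text \<open>
  Stability of the recursion \<open>z\<^sub>k\<^sub>+\<^sub>1 = T z\<^sub>k - D z\<^sub>k\<^sub>-\<^sub>1\<close> with symmetric operators. For numbers, the
  roots of \<open>\<lambda>\<^sup>2 - T \<lambda> + D\<close> lie inside the unit disc iff \<open>1 + D - T\<close>, \<open>1 + D + T\<close> and \<open>1 - D\<close> are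
  positive, and the Schur--Cohn form
  \<open>V (u, w) = (1 + D) (u\<^sup>2 + w\<^sup>2) - 2 T u w\<close> is a Lyapunov function with decrease
  \<open>(1 - D) (z\<^sub>k\<^sub>+\<^sub>1 - z\<^sub>k\<^sub>-\<^sub>1)\<^sup>2\<close>. Given the three positivity conditions, both properties of \<open>V\<close>
  rest on the symmetry of \<open>T\<close> and \<open>D\<close> alone, so the argument carries over from numbers to operators
  without a diagonalization. One step need not decrease \<open>V\<close> strictly, since \<open>z\<^sub>k\<^sub>+\<^sub>1 = z\<^sub>k\<^sub>-\<^sub>1\<close> is possible for a single \<open>k\<close>; two consecutive steps do,
  because \<open>V\<close> is controlled by the two differences together.
\<close>
lemma two_term_recursion_power_halves:
  fixes T D :: "'a::real_inner \<Rightarrow> 'a"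
  assumes T: "bounded_linear T" and D: "bounded_linear D"
    and T_sym: "\<And>u v. T u \<bullet> v = u \<bullet> T v" and D_sym: "\<And>u v. D u \<bullet> v = u \<bullet> D v"
    and p: "0 < p"
    and minus: "\<And>v. p * (v \<bullet> v) \<le> v \<bullet> (v + D v - T v)"
    and plus: "\<And>v. p * (v \<bullet> v) \<le> v \<bullet> (v + D v + T v)"
    and det: "\<And>v. p * (v \<bullet> v) \<le> v \<bullet> (v - D v)"
  defines "A \<equiv> \<lambda>(u, w). (T u - D w, u)"
  obtains m where "0 < m" "\<And>z. norm ((A ^^ m) z) \<le> norm z / 2"
proof -
  interpret T: bounded_linear T by (rule T)
  interpret D: bounded_linear D by (rule D)
  define V where "V = (\<lambda>(u, w). u \<bullet> (u + D u) + w \<bullet> (w + D w) - 2 * (T u \<bullet> w))"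
  obtain t where t: "0 \<le> t" "\<And>v. norm (T v) \<le> t * norm v"
    using T.nonneg_bounded by (auto simp: mult.commute)
  obtain d where d: "0 \<le> d" "\<And>v. norm (D v) \<le> d * norm v"
    using D.nonneg_bounded by (auto simp: mult.commute)
  have V_lower: "p * (norm z)\<^sup>2 \<le> V z" for z
  proof (cases z)
    case (Pair u w)
    \<comment> \<open>The form is diagonal in the variables \<open>u + w\<close> and \<open>u - w\<close>.\<close>
    have "2 * V z = (u + w) \<bullet> (u + w + D (u + w) - T (u + w)) + (u - w) \<bullet> (u - w + D (u - w) + T (u - w))"
      using T_sym[of w u] D_sym[of w u]
      by (simp add: Pair V_def T.add T.diff D.add D.diff inner_simps inner_commute)
    moreover have "(norm z)\<^sup>2 = u \<bullet> u + w \<bullet> w"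
      by (simp add: Pair norm_Pair dot_square_norm)
    moreover have "p * ((u + w) \<bullet> (u + w)) + p * ((u - w) \<bullet> (u - w)) = 2 * (p * (u \<bullet> u + w \<bullet> w))"
      by (simp add: inner_simps inner_commute algebra_simps)
    ultimately have "2 * (p * (norm z)\<^sup>2) \<le> 2 * V z"
      using minus[of "u + w"] plus[of "u - w"] by simp
    then show ?thesis by simp
  qed
  define C where "C = 1 + d + t"
  have V_upper: "V z \<le> C * (norm z)\<^sup>2" for z
  proof (cases z)
    case (Pair u w)
    have *: "v \<bullet> (v + D v) \<le> (1 + d) * (v \<bullet> v)" for v
    proof -
      have "v \<bullet> D v \<le> norm v * norm (D v)" by (rule norm_cauchy_schwarz)
      also have "\<dots> \<le> norm v * (d * norm v)" by (intro mult_left_mono d) simp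
      also have "\<dots> = d * (v \<bullet> v)" by (metis mult.left_commute power2_eq_square power2_norm_eq_inner)
      finally show ?thesis by (simp add: inner_add_right distrib_right)
    qed
    have "- 2 * (T u \<bullet> w) \<le> 2 * (norm (T u) * norm w)"
      using norm_cauchy_schwarz[of "- T u" w] unfolding inner_minus_left norm_minus_cancel by linarith
    also have "\<dots> \<le> 2 * ((t * norm u) * norm w)"
      using mult_right_mono[OF t(2)[of u], of "norm w"] by simp
    also have "\<dots> = t * (2 * norm u * norm w)" by simp
    also have "\<dots> \<le> t * ((norm u)\<^sup>2 + (norm w)\<^sup>2)"
      using t by (intro mult_left_mono sum_squares_bound)
    finally show ?thesis using *[of u] *[of w]
      by (simp add: Pair V_def C_def norm_Pair dot_square_norm algebra_simps)
  qed
  have V_step: "V (A (u, w)) = V (u, w) - (fst (A (u, w)) - w) \<bullet> (fst (A (u, w)) - w - D (fst (A (u, w)) - w))"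
    for u w
  proof -
    define y where "y = T u - D w"
    have Tu: "T u = y + D w" by (simp add: y_def)
    have "T y \<bullet> u = y \<bullet> T u" by (rule T_sym)
    then show ?thesis using D_sym[of w y]
      by (simp add: V_def A_def y_def[symmetric] Tu D.diff inner_simps inner_commute)
  qed
  define \<rho> where "\<rho> = 1 - p\<^sup>2 / ((2 + t)\<^sup>2 + p\<^sup>2)"
  have den: "0 < (2 + t)\<^sup>2 + p\<^sup>2" using p by (simp add: add_nonneg_pos)
  have rho: "0 \<le> \<rho>" "\<rho> < 1" using p den by (auto simp: \<rho>_def field_simps)
  have V_contract: "V (A (A z)) \<le> \<rho> * V z" for z
  proof (cases z)
    case (Pair u w)
    define y where "y = T u - D w"
    define x where "x = T y - D u"
    have Az: "A z = (y, u)" "A (A z) = (x, y)" by (auto simp: Pair A_def y_def x_def)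
    define \<delta> where "\<delta> = (norm (y - w))\<^sup>2 + (norm (x - u))\<^sup>2"
    have drop: "p * \<delta> \<le> V z - V (A (A z))"
      using V_step[of u w] V_step[of y u] det[of "y - w"] det[of "x - u"] Az
      by (simp add: Pair \<delta>_def A_def y_def[symmetric] x_def[symmetric] dot_square_norm algebra_simps)
    \<comment> \<open>\<open>y - w = T u - (1 + D) w\<close> and \<open>(x - u) - T (y - w) = T w - (1 + D) u\<close>, so the form is
        the pairing of these two residuals with \<open>w\<close> and \<open>u\<close>.\<close>
    have "V z = - ((x - u) \<bullet> u) + T (y - w) \<bullet> u - (y - w) \<bullet> w"
      using T_sym[of w u] D_sym[of w u]
      by (simp add: Pair V_def x_def y_def T.diff T.add inner_simps inner_commute)
    also have "\<dots> \<le> norm (x - u) * norm u + t * norm (y - w) * norm u + norm (y - w) * norm w"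
    proof -
      have "T (y - w) \<bullet> u \<le> norm (T (y - w)) * norm u" by (rule norm_cauchy_schwarz)
      also have "\<dots> \<le> t * norm (y - w) * norm u" by (intro mult_right_mono t) simp
      finally show ?thesis
        using norm_cauchy_schwarz[of "- (x - u)" u] norm_cauchy_schwarz[of "- (y - w)" w]
        unfolding inner_minus_left norm_minus_cancel by linarith
    qed
    also have "\<dots> \<le> sqrt \<delta> * norm z + t * sqrt \<delta> * norm z + sqrt \<delta> * norm z"
    proof -
      have "norm (x - u) \<le> sqrt \<delta>" "norm (y - w) \<le> sqrt \<delta>"
        by (auto simp: \<delta>_def intro!: real_le_rsqrt)
      moreover have "norm u \<le> norm z" "norm w \<le> norm z"
        by (auto simp: Pair norm_Pair intro!: real_le_rsqrt)
      moreover have "0 \<le> \<delta>" by (simp add: \<delta>_def)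
      ultimately show ?thesis using t by (intro add_mono mult_mono) auto
    qed
    finally have V_le: "V z \<le> (2 + t) * sqrt \<delta> * norm z" by (simp add: algebra_simps)
    have V0: "0 \<le> V z" using V_lower[of z] p by (meson order_trans mult_nonneg_nonneg less_imp_le zero_le_power2)
    have \<delta>0: "0 \<le> \<delta>" by (simp add: \<delta>_def)
    have mono: "V (A (A z)) \<le> V z" 
    proof -
      have "0 \<le> p * \<delta>" using p \<delta>0 by simp
      then show ?thesis using drop by linarith
    qed
    have "(V z)\<^sup>2 \<le> ((2 + t) * sqrt \<delta> * norm z)\<^sup>2" using V_le V0 by (intro power_mono)
    also have "\<dots> = (2 + t)\<^sup>2 * (\<delta> * (norm z)\<^sup>2)" using \<delta>0 by (simp add: power_mult_distrib)
    finally have "p\<^sup>2 * (V z)\<^sup>2 \<le> p\<^sup>2 * ((2 + t)\<^sup>2 * (\<delta> * (norm z)\<^sup>2))" by (intro mult_left_mono) auto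
    also have "\<dots> = (2 + t)\<^sup>2 * ((p * \<delta>) * (p * (norm z)\<^sup>2))" by (simp add: power2_eq_square)
    also have "\<dots> \<le> (2 + t)\<^sup>2 * ((V z - V (A (A z))) * V z)"
      using drop V_lower[of z] p mono by (intro mult_left_mono mult_mono) auto
    finally have main: "V z * (p\<^sup>2 * V z) \<le> V z * ((2 + t)\<^sup>2 * (V z - V (A (A z))))"
      by (simp add: power2_eq_square algebra_simps)
    have "p\<^sup>2 * V z \<le> ((2 + t)\<^sup>2 + p\<^sup>2) * (V z - V (A (A z)))"
    proof (cases "V z = 0")
      case True
      then show ?thesis using mono den by (simp add: mult_nonneg_nonpos)
    next
      case False
      then have "p\<^sup>2 * V z \<le> (2 + t)\<^sup>2 * (V z - V (A (A z)))"
        using main V0 by (simp add: mult_le_cancel_left)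
      also have "\<dots> \<le> ((2 + t)\<^sup>2 + p\<^sup>2) * (V z - V (A (A z)))"
        using mono by (intro mult_right_mono) auto
      finally show ?thesis .
    qed
    then have "p\<^sup>2 * V z / ((2 + t)\<^sup>2 + p\<^sup>2) \<le> V z - V (A (A z))"
      using den by (simp only: pos_divide_le_eq mult.commute)
    then show ?thesis by (simp add: \<rho>_def left_diff_distrib)
  qed
  have V_pow: "V ((A ^^ (2 * n)) z) \<le> \<rho> ^ n * V z" for n z
  proof (induction n)
    case (Suc n)
    have "V ((A ^^ (2 * Suc n)) z) \<le> \<rho> * V ((A ^^ (2 * n)) z)" using V_contract by simp
    also have "\<dots> \<le> \<rho> * (\<rho> ^ n * V z)" using Suc rho by (intro mult_left_mono)
    finally show ?case by simp
  qed simp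
  have C: "0 < C" using t d by (simp add: C_def)
  have "(\<lambda>n. \<rho> ^ n * (C / p)) \<longlonglongrightarrow> 0 * (C / p)"
    using rho by (intro tendsto_intros LIMSEQ_realpow_zero)
  from order_tendstoD(2)[OF this, of "1 / 4"]
  have "eventually (\<lambda>n. \<rho> ^ n * (C / p) < 1 / 4) sequentially" by simp
  then obtain n0 where "\<And>n. n0 \<le> n \<Longrightarrow> \<rho> ^ n * (C / p) < 1 / 4"
    by (auto simp: eventually_sequentially)
  then have n: "\<rho> ^ Suc n0 * (C / p) \<le> 1 / 4" by (meson le_SucI less_imp_le order_refl)
  show thesis
  proof (rule that[of "2 * Suc n0"])
    fix z
    let ?y = "(A ^^ (2 * Suc n0)) z"
    have "p * (norm ?y)\<^sup>2 \<le> V ?y" by (rule V_lower)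
    also have "\<dots> \<le> \<rho> ^ Suc n0 * V z" by (rule V_pow)
    also have "\<dots> \<le> \<rho> ^ Suc n0 * (C * (norm z)\<^sup>2)" using rho V_upper by (intro mult_left_mono) auto
    also have "\<dots> = p * (\<rho> ^ Suc n0 * (C / p) * (norm z)\<^sup>2)" using p by simp
    also have "\<dots> \<le> p * (1 / 4 * (norm z)\<^sup>2)" using p n by (intro mult_left_mono mult_right_mono) auto
    finally have "(norm ?y)\<^sup>2 \<le> (norm z / 2)\<^sup>2" using p by (simp add: power_divide)
    then show "norm ?y \<le> norm z / 2" by (rule power2_le_imp_le) simp
  qed simp
qed

section \<open>Smooth strongly convex functions\<close>

lemma DERIV_along_line:
  assumes "\<And>x. GDERIV g x :> G x"
  shows "((\<lambda>t. g (x + t *\<^sub>R v)) has_real_derivative (v \<bullet> G (x + t *\<^sub>R v))) (at t)"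
proof -
  have "((\<lambda>t. x + t *\<^sub>R v) has_derivative (\<lambda>s. s *\<^sub>R v)) (at t)"
    by (auto intro!: derivative_eq_intros)
  from has_derivative_compose[OF this assms[unfolded gderiv_def]]
  show ?thesis unfolding has_field_derivative_def
    by (rule has_derivative_eq_rhs) (auto simp: fun_eq_iff)
qed

text \<open>
  The mean value theorem in the direction \<open>u\<close> turns the second difference into \<open>t\<close> times a difference
  of gradients at points that are \<open>t *\<^sub>R v\<close> apart, and differentiability of the gradient at the single
  point \<open>x\<close> evaluates that difference up to \<open>o(t)\<close>. The difference quotient is symmetric in \<open>u\<close> and
  \<open>v\<close> while the limit found here is not visibly so; this yields the symmetry of the Hessian.
\<close>
lemma second_difference_tendsto:
  fixes g :: "'a::real_inner \<Rightarrow> real"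
  assumes grad: "\<And>x. GDERIV g x :> G x"
    and H: "(G has_derivative H) (at x)"
  shows "((\<lambda>t. (g (x + t *\<^sub>R (u + v)) - g (x + t *\<^sub>R u) - g (x + t *\<^sub>R v) + g x) / t\<^sup>2) \<longlongrightarrow> H v \<bullet> u)
    (at_right 0)"
proof (rule tendstoI)
  fix e :: real assume e: "0 < e"
  interpret H: bounded_linear H using H by (rule has_derivative_bounded_linear)
  define N where "N = norm u + norm v + 1"
  have N: "0 < N" by (simp add: N_def add_nonneg_pos)
  \<comment> \<open>Two remainders of size \<open>\<epsilon> * (t * N)\<close>, paired with \<open>u\<close> of norm less than \<open>N\<close>, must add up to
      less than \<open>e * t\<close>.\<close>
  define \<epsilon> where "\<epsilon> = e / (2 * N * N)"
  have \<epsilon>: "0 < \<epsilon>" using e N by (simp add: \<epsilon>_def)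
  obtain d where d: "0 < d"
    "\<And>y. norm (y - x) < d \<Longrightarrow> norm (G y - G x - H (y - x)) \<le> \<epsilon> * norm (y - x)"
    using H[unfolded has_derivative_at_alt] \<epsilon> by blast
  have "dist ((g (x + t *\<^sub>R (u + v)) - g (x + t *\<^sub>R u) - g (x + t *\<^sub>R v) + g x) / t\<^sup>2) (H v \<bullet> u) < e"
    if t: "0 < t" "t < d / N" for t
  proof -
    define \<phi> where "\<phi> s = g (x + t *\<^sub>R v + s *\<^sub>R u) - g (x + s *\<^sub>R u)" for s
    have "(\<phi> has_real_derivative (u \<bullet> G (x + t *\<^sub>R v + s *\<^sub>R u) - u \<bullet> G (x + s *\<^sub>R u))) (at s)" for s
      unfolding \<phi>_def by (intro DERIV_diff DERIV_along_line grad)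
    from MVT2[OF t(1) this] obtain s where s: "0 < s" "s < t"
      and mvt: "\<phi> t - \<phi> 0 = t * (u \<bullet> G (x + t *\<^sub>R v + s *\<^sub>R u) - u \<bullet> G (x + s *\<^sub>R u))"
      by auto
    define r where "r w = G (x + w) - G x - H w" for w
    have r: "norm (r w) \<le> \<epsilon> * (t * N)" if "norm w \<le> t * N - t" for w
    proof -
      have "norm w < d" using that t N by (simp add: field_simps)
      then have "norm (r w) \<le> \<epsilon> * norm w" using d(2)[of "x + w"] by (simp add: r_def)
      also have "\<dots> \<le> \<epsilon> * (t * N)" using that t \<epsilon> by (intro mult_left_mono) auto
      finally show ?thesis .
    qed
    have r1: "norm (r (t *\<^sub>R v + s *\<^sub>R u)) \<le> \<epsilon> * (t * N)"
    proof (rule r)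
      have "norm (t *\<^sub>R v + s *\<^sub>R u) \<le> t * norm v + s * norm u"
        using norm_triangle_ineq[of "t *\<^sub>R v" "s *\<^sub>R u"] s t by simp
      also have "s * norm u \<le> t * norm u" using s by (intro mult_right_mono) auto
      finally show "norm (t *\<^sub>R v + s *\<^sub>R u) \<le> t * N - t" by (simp add: N_def algebra_simps)
    qed
    have r2: "norm (r (s *\<^sub>R u)) \<le> \<epsilon> * (t * N)"
    proof (rule r)
      have "norm (s *\<^sub>R u) \<le> t * norm u" using s by (simp add: mult_right_mono)
      moreover have "0 \<le> t * norm v" using t by simp
      ultimately show "norm (s *\<^sub>R u) \<le> t * N - t" by (simp add: N_def algebra_simps)
    qed
    have "\<phi> t - \<phi> 0 = t * (t * (H v \<bullet> u) + u \<bullet> (r (t *\<^sub>R v + s *\<^sub>R u) - r (s *\<^sub>R u)))"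
      unfolding mvt r_def
      by (simp add: H.add H.scaleR inner_simps inner_commute algebra_simps)
    moreover have "\<phi> t - \<phi> 0 = g (x + t *\<^sub>R (u + v)) - g (x + t *\<^sub>R u) - g (x + t *\<^sub>R v) + g x"
      by (simp add: \<phi>_def algebra_simps)
    ultimately have "(g (x + t *\<^sub>R (u + v)) - g (x + t *\<^sub>R u) - g (x + t *\<^sub>R v) + g x) / t\<^sup>2 - H v \<bullet> u
        = u \<bullet> (r (t *\<^sub>R v + s *\<^sub>R u) - r (s *\<^sub>R u)) / t"
      using t by (simp add: power2_eq_square field_simps)
    moreover have "\<bar>u \<bullet> (r (t *\<^sub>R v + s *\<^sub>R u) - r (s *\<^sub>R u))\<bar> < e * t"
    proof -
      have "\<bar>u \<bullet> (r (t *\<^sub>R v + s *\<^sub>R u) - r (s *\<^sub>R u))\<bar> \<le> norm u * norm (r (t *\<^sub>R v + s *\<^sub>R u) - r (s *\<^sub>R u))"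
        by (rule Cauchy_Schwarz_ineq2)
      also have "\<dots> \<le> norm u * (2 * (\<epsilon> * (t * N)))"
        using r1 r2 norm_triangle_ineq4[of "r (t *\<^sub>R v + s *\<^sub>R u)" "r (s *\<^sub>R u)"]
        by (intro mult_left_mono) auto
      also have "\<dots> < N * (2 * (\<epsilon> * (t * N)))"
        using \<epsilon> t N by (intro mult_strict_right_mono) (auto simp: N_def add_nonneg_pos)
      also have "\<dots> = e * t" using N by (simp add: \<epsilon>_def field_simps)
      finally show ?thesis .
    qed
    ultimately show ?thesis using t by (simp only: dist_real_def abs_divide) (simp add: pos_divide_less_eq)
  qed
  then show "\<forall>\<^sub>F t in at_right 0.
      dist ((g (x + t *\<^sub>R (u + v)) - g (x + t *\<^sub>R u) - g (x + t *\<^sub>R v) + g x) / t\<^sup>2) (H v \<bullet> u) < e"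
    using d(1) N by (intro eventually_at_rightI[of 0 "d / N"]) auto
qed

lemma derivative_of_gradient_symmetric:
  fixes g :: "'a::real_inner \<Rightarrow> real"
  assumes "\<And>x. GDERIV g x :> G x" and "(G has_derivative H) (at x)"
  shows "H u \<bullet> v = u \<bullet> H v"
proof -
  note lim = second_difference_tendsto[OF assms]
  have "H u \<bullet> v = H v \<bullet> u"
    using tendsto_unique[OF trivial_limit_at_right_real lim[of v u]]
      lim[of u v] by (simp add: add.commute algebra_simps)
  then show ?thesis by (simp add: inner_commute)
qed

text \<open>
  The difference of the two sides along the segment from \<open>x\<close> to \<open>y\<close> vanishes at the start and has a
  nonpositive derivative by the Cauchy--Schwarz inequality and the Lipschitz bound.
\<close>
lemma descent_lemma:
  fixes g :: "'a::real_inner \<Rightarrow> real"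
  assumes grad: "\<And>x. GDERIV g x :> G x" and lip: "L-lipschitz_on UNIV G"
  shows "g y \<le> g x + G x \<bullet> (y - x) + L / 2 * (norm (y - x))\<^sup>2"
proof -
  define v where "v = y - x"
  define \<phi> where "\<phi> t = g (x + t *\<^sub>R v) - t * (v \<bullet> G x) - L / 2 * t\<^sup>2 * (v \<bullet> v)" for t
  have der: "(\<phi> has_real_derivative (v \<bullet> G (x + t *\<^sub>R v) - v \<bullet> G x - L * t * (v \<bullet> v))) (at t)" for t
    unfolding \<phi>_def by (auto intro!: derivative_eq_intros DERIV_along_line[OF grad])
  have "v \<bullet> G (x + t *\<^sub>R v) - v \<bullet> G x - L * t * (v \<bullet> v) \<le> 0" if "0 \<le> t" for t
  proof -
    have "v \<bullet> (G (x + t *\<^sub>R v) - G x) \<le> norm v * norm (G (x + t *\<^sub>R v) - G x)"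
      by (rule norm_cauchy_schwarz)
    also have "\<dots> \<le> norm v * (L * (t * norm v))"
      using lipschitz_onD[OF lip, of "x + t *\<^sub>R v" x] that by (intro mult_left_mono) (auto simp: dist_norm)
    also have "\<dots> = L * t * (v \<bullet> v)" by (simp add: dot_square_norm power2_eq_square)
    finally show ?thesis by (simp add: inner_diff_right)
  qed
  then have "\<phi> 1 \<le> \<phi> 0"
    using der by (intro DERIV_nonpos_imp_nonincreasing[of 0 1 \<phi>] exI conjI) auto
  then show ?thesis by (simp add: \<phi>_def v_def dot_square_norm inner_commute)
qed

text \<open>
  The modulus is a parameter because it enters the quantitative estimates below, whereas
  \<^const>\<open>strongly_convex\<close> hides it behind an existential quantifier.
\<close>
definition strongly_convex_with :: "real \<Rightarrow> ('a::real_normed_vector \<Rightarrow> real) \<Rightarrow> bool" where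
  "strongly_convex_with \<mu> g \<longleftrightarrow> 0 < \<mu> \<and> (\<forall>x y. \<forall>t\<in>{0..1}.
      g ((1 - t) *\<^sub>R x + t *\<^sub>R y)
        \<le> (1 - t) * g x + t * g y - \<mu> / 2 * t * (1 - t) * (norm (x - y))\<^sup>2)"

text \<open>
  Subtracting \<open>g x\<close> from the defining inequality, dividing by \<open>t\<close> and letting \<open>t\<close> decrease to zero
  leaves the directional derivative on the left.
\<close>
lemma strongly_convex_first_order:
  fixes g :: "'a::real_inner \<Rightarrow> real"
  assumes grad: "\<And>x. GDERIV g x :> G x" and conv: "strongly_convex_with \<mu> g"
  shows "g x + G x \<bullet> (y - x) + \<mu> / 2 * (norm (y - x))\<^sup>2 \<le> g y"
proof -
  define v where "v = y - x"
  have "((\<lambda>t. (g (x + t *\<^sub>R v) - g (x + 0 *\<^sub>R v)) / t) \<longlongrightarrow> v \<bullet> G (x + 0 *\<^sub>R v)) (at_right 0)"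
    using DERIV_along_line[OF grad, of x v 0] unfolding DERIV_def
    by (simp add: filterlim_at_split)
  moreover have "((\<lambda>t. g y - g x - \<mu> / 2 * (1 - t) * (norm v)\<^sup>2)
      \<longlongrightarrow> g y - g x - \<mu> / 2 * (1 - 0) * (norm v)\<^sup>2) (at_right 0)"
    by (intro tendsto_intros)
  moreover have "(g (x + t *\<^sub>R v) - g (x + 0 *\<^sub>R v)) / t \<le> g y - g x - \<mu> / 2 * (1 - t) * (norm v)\<^sup>2"
    if t: "0 < t" "t < 1" for t
  proof -
    have "g ((1 - t) *\<^sub>R x + t *\<^sub>R y)
        \<le> (1 - t) * g x + t * g y - \<mu> / 2 * t * (1 - t) * (norm (x - y))\<^sup>2"
      using conv t by (auto simp: strongly_convex_with_def)
    moreover have "(1 - t) *\<^sub>R x + t *\<^sub>R y = x + t *\<^sub>R v" by (simp add: v_def algebra_simps)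
    moreover have "norm (x - y) = norm v" by (simp add: v_def norm_minus_commute)
    ultimately have "g (x + t *\<^sub>R v) - g x \<le> (g y - g x - \<mu> / 2 * (1 - t) * (norm v)\<^sup>2) * t"
      by (simp add: algebra_simps)
    then show ?thesis using t by (simp add: pos_divide_le_eq)
  qed
  then have "\<forall>\<^sub>F t in at_right 0. (g (x + t *\<^sub>R v) - g (x + 0 *\<^sub>R v)) / t \<le> g y - g x - \<mu> / 2 * (1 - t) * (norm v)\<^sup>2"
    by (intro eventually_at_rightI[of 0 1]) auto
  ultimately have "v \<bullet> G (x + 0 *\<^sub>R v) \<le> g y - g x - \<mu> / 2 * (1 - 0) * (norm v)\<^sup>2"
    by (intro tendsto_le[OF trivial_limit_at_right_real])
  then show ?thesis by (simp add: v_def inner_commute)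
qed

lemma strongly_convex_monotone:
  fixes g :: "'a::real_inner \<Rightarrow> real"
  assumes grad: "\<And>x. GDERIV g x :> G x" and conv: "strongly_convex_with \<mu> g"
  shows "\<mu> * (norm (x - y))\<^sup>2 \<le> (G x - G y) \<bullet> (x - y)"
    and "\<mu> * norm (x - y) \<le> norm (G x - G y)"
proof -
  note first = strongly_convex_first_order[OF grad conv]
  have "G x \<bullet> (y - x) = - (G x \<bullet> (x - y))" by (simp add: inner_diff_right)
  then show mono: "\<mu> * (norm (x - y))\<^sup>2 \<le> (G x - G y) \<bullet> (x - y)"
    using first[of x y] first[of y x] by (simp add: norm_minus_commute[of y x] inner_diff_left)
  also have "\<dots> \<le> norm (G x - G y) * norm (x - y)" by (rule norm_cauchy_schwarz)
  finally show "\<mu> * norm (x - y) \<le> norm (G x - G y)"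
    by (cases "x = y") (auto simp: power2_eq_square)
qed

text \<open>
  Bounds on difference quotients of a vector field pass to its derivative: strong monotonicity bounds
  the quadratic form of the Hessian from below, Lipschitz continuity bounds it from above.
\<close>
lemma derivative_of_gradient_bounds:
  fixes G :: "'a::real_inner \<Rightarrow> 'a"
  assumes H: "(G has_derivative H) (at x)"
  shows "(\<And>y z. \<mu> * (norm (y - z))\<^sup>2 \<le> (G y - G z) \<bullet> (y - z)) \<Longrightarrow> \<mu> * (v \<bullet> v) \<le> v \<bullet> H v"
    and "L-lipschitz_on UNIV G \<Longrightarrow> v \<bullet> H v \<le> L * (v \<bullet> v)"
proof -
  have "((\<lambda>t. x + t *\<^sub>R v) has_derivative (\<lambda>s. s *\<^sub>R v)) (at 0)"
    by (auto intro!: derivative_eq_intros)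
  moreover have "(G has_derivative H) (at (x + 0 *\<^sub>R v))" using H by simp
  ultimately have "((\<lambda>t. G (x + t *\<^sub>R v)) has_derivative (\<lambda>s. H (s *\<^sub>R v))) (at 0)"
    by (rule has_derivative_compose)
  then have "((\<lambda>t. v \<bullet> G (x + t *\<^sub>R v)) has_derivative (\<lambda>s. v \<bullet> H (s *\<^sub>R v))) (at 0)"
    by (rule has_derivative_inner_right)
  moreover have "(\<lambda>s. v \<bullet> H (s *\<^sub>R v)) = (*) (v \<bullet> H v)"
    using linear_scale[OF has_derivative_linear[OF H]] by (auto simp: fun_eq_iff)
  ultimately have "((\<lambda>t. v \<bullet> G (x + t *\<^sub>R v)) has_real_derivative (v \<bullet> H v)) (at 0)"
    by (simp add: has_field_derivative_def)
  then have lim: "((\<lambda>t. (v \<bullet> G (x + t *\<^sub>R v) - v \<bullet> G x) / t) \<longlongrightarrow> v \<bullet> H v) (at_right 0)"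
    unfolding DERIV_def by (simp add: filterlim_at_split)
  { assume mono: "\<And>y z. \<mu> * (norm (y - z))\<^sup>2 \<le> (G y - G z) \<bullet> (y - z)"
    have "\<mu> * (v \<bullet> v) \<le> (v \<bullet> G (x + t *\<^sub>R v) - v \<bullet> G x) / t" if "0 < t" for t
    proof -
      have "t * (\<mu> * (v \<bullet> v) * t) \<le> t * (v \<bullet> G (x + t *\<^sub>R v) - v \<bullet> G x)"
        using mono[of "x + t *\<^sub>R v" x]
        by (simp add: power_mult_distrib power2_norm_eq_inner inner_diff_left inner_diff_right
            inner_commute right_diff_distrib mult_ac power2_eq_square[of t])
      then show ?thesis using that by (simp add: pos_le_divide_eq)
    qed
    then show "\<mu> * (v \<bullet> v) \<le> v \<bullet> H v"
      by (intro tendsto_lowerbound[OF lim] trivial_limit_at_right_real eventually_at_rightI[of 0 1]) auto }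
  { assume lip: "L-lipschitz_on UNIV G"
    have "(v \<bullet> G (x + t *\<^sub>R v) - v \<bullet> G x) / t \<le> L * (v \<bullet> v)" if "0 < t" for t
    proof -
      have "v \<bullet> (G (x + t *\<^sub>R v) - G x) \<le> norm v * norm (G (x + t *\<^sub>R v) - G x)"
        by (rule norm_cauchy_schwarz)
      also have "\<dots> \<le> norm v * (L * (t * norm v))"
        using lipschitz_onD[OF lip, of "x + t *\<^sub>R v" x] that by (intro mult_left_mono) (auto simp: dist_norm)
      also have "\<dots> = L * (v \<bullet> v) * t" by (simp add: dot_square_norm power2_eq_square)
      finally show ?thesis using that by (simp add: inner_diff_right pos_divide_le_eq)
    qed
    then show "v \<bullet> H v \<le> L * (v \<bullet> v)"
      by (intro tendsto_upperbound[OF lim] trivial_limit_at_right_real eventually_at_rightI[of 0 1]) auto }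
qed

lemma the_minimizer_of_strongly_convex:
  fixes g :: "'a::euclidean_space \<Rightarrow> real"
  assumes grad: "\<And>x. GDERIV g x :> G x" and conv: "strongly_convex_with \<mu> g"
    and lev: "level_bounded g"
  shows "G (the_minimizer g) = 0" and "g (the_minimizer g) \<le> g y"
proof -
  have mu: "0 < \<mu>" using conv by (simp add: strongly_convex_with_def)
  have cont: "continuous_on UNIV g"
    using grad unfolding gderiv_def
    by (metis has_derivative_continuous continuous_at_imp_continuous_on)
  define S where "S = {x. g x \<le> g 0}"
  have "closed S" unfolding S_def using cont by (intro closed_Collect_le continuous_on_const)
  moreover have "bounded S" using lev by (simp add: S_def level_bounded_def)
  ultimately have "compact S" by (simp add: compact_eq_bounded_closed)
  moreover have "S \<noteq> {}" by (auto simp: S_def)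
  ultimately obtain m where m: "m \<in> S" "\<And>y. y \<in> S \<Longrightarrow> g m \<le> g y"
    using continuous_attains_inf[of S g] continuous_on_subset[OF cont] by auto
  have min: "g m \<le> g y" for y using m(2)[of y] m(1) by (cases "y \<in> S") (simp_all add: S_def)
  have G_zero: "G z = 0" if z: "\<And>y. g z \<le> g y" for z
  proof -
    have "(g has_derivative (\<lambda>h. h \<bullet> G z)) (at z)" using grad[of z] by (simp add: gderiv_def)
    then have "(\<lambda>h. h \<bullet> G z) = (\<lambda>h. 0)"
      using z by (intro differential_zero_maxmin[of z UNIV]) auto
    then have "G z \<bullet> G z = 0" by metis
    then show ?thesis by simp
  qed
  have "the_minimizer g = m"
    unfolding the_minimizer_def
  proof (rule the_equality)
    show "is_arg_min g (\<lambda>_. True) m" using min by (auto simp: is_arg_min_def not_less)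
    fix z assume "is_arg_min g (\<lambda>_. True) z"
    then have "G z = 0" by (intro G_zero) (auto simp: is_arg_min_def not_less)
    then have "\<mu> * norm (z - m) \<le> 0"
      using strongly_convex_monotone(2)[OF grad conv, of z m] G_zero[of m] min by simp
    then show "z = m" using mu by (simp add: mult_le_0_iff)
  qed
  then show "G (the_minimizer g) = 0" "g (the_minimizer g) \<le> g y" using G_zero[of m] min by auto
qed

section \<open>The step condition\<close>

text \<open>
  Both alternatives of the parameter condition serve one purpose, with \<open>c = \<gamma> L / 2\<close>: they keep
  \<open>1 - c - |a - 2 c b| - c b\<^sup>2\<close> away from zero. That number is the margin by which the coefficient of
  the new squared increment exceeds the coefficient of the old one in the energy estimate
  \<open>inertial_step_decrease\<close> below. The absolute value expands to \<open>1 + a - c (1 + b)\<^sup>2\<close> if \<open>a \<le> 2 c b\<close> and to \<open>1 - a - c (1 - b)\<^sup>2\<close> otherwise. The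
  second alternative covers both signs because \<open>c b \<le> a\<close> makes \<open>1 - 3 a - c (1 - b)\<^sup>2\<close> the smallest
  of the three expressions.
\<close>
lemma condition_B_gap:
  assumes B: "condition_B L a b \<gamma>"
    and ab: "\<And>k. 0 \<le> b k" and c: "\<And>k. 0 \<le> \<gamma> k * L / 2" "\<And>k. \<gamma> k * L / 2 \<le> 1"
  obtains \<tau> where "0 < \<tau>"
    and "\<And>k. \<tau> \<le> 1 - \<gamma> k * L / 2 - \<bar>a k - 2 * (\<gamma> k * L / 2) * b k\<bar> - \<gamma> k * L / 2 * (b k)\<^sup>2"
proof -
  define C where "C k = \<gamma> k * L / 2" for k
  obtain \<tau> where \<tau>: "0 < \<tau>" and
    cases: "(\<forall>k. \<tau> < (1 + a k) - C k * (1 + b k)\<^sup>2 \<and> a k < C k * b k) \<or>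
      (\<forall>k. \<tau> < (1 - 3 * a k) - C k * (1 - b k)\<^sup>2 \<and>
           (b k \<le> a k \<or> (C k * b k \<le> a k \<and> a k < b k)))"
    using B unfolding condition_B_def C_def by blast
  have "\<tau> \<le> 1 - C k - \<bar>a k - 2 * C k * b k\<bar> - C k * (b k)\<^sup>2" for k
  proof -
    have Cb: "0 \<le> C k * b k" "C k * b k \<le> b k"
      using ab[of k] c[of k] by (simp_all only: C_def mult_nonneg_nonneg mult_left_le_one_le)
    have sq: "C k * (1 + b k)\<^sup>2 = C k + 2 * (C k * b k) + C k * (b k)\<^sup>2"
      "C k * (1 - b k)\<^sup>2 = C k - 2 * (C k * b k) + C k * (b k)\<^sup>2"
      by (simp_all add: power2_eq_square algebra_simps)
    have abs: "\<bar>a k - 2 * C k * b k\<bar> = \<bar>a k - 2 * (C k * b k)\<bar>" by (simp add: mult.assoc)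
    from cases show ?thesis
    proof
      assume "\<forall>k. \<tau> < (1 + a k) - C k * (1 + b k)\<^sup>2 \<and> a k < C k * b k"
      then have "\<tau> < (1 + a k) - C k * (1 + b k)\<^sup>2" "a k < C k * b k" by auto
      then show ?thesis using Cb unfolding sq abs by linarith
    next
      assume "\<forall>k. \<tau> < (1 - 3 * a k) - C k * (1 - b k)\<^sup>2 \<and>
           (b k \<le> a k \<or> (C k * b k \<le> a k \<and> a k < b k))"
      then have "\<tau> < (1 - 3 * a k) - C k * (1 - b k)\<^sup>2" "C k * b k \<le> a k"
        using Cb by (auto intro: order_trans)
      then show ?thesis using Cb unfolding sq abs by linarith
    qed
  qed
  then show thesis using that[of \<tau>] \<tau> by (simp add: C_def)
qed

text \<open>
  The eigenvalue condition says nothing when \<open>a = 1\<close> or \<open>b = 1\<close>. In the limit the step condition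
  rules out the first case and leaves the second one only with such short steps that stability holds
  anyway. With \<open>c = \<gamma> L / 2\<close>, the first alternative gives \<open>a \<le> c b \<le> c < 1\<close> and, for \<open>b = 1\<close>,
  \<open>0 < 1 + a - 4 c \<le> 1 - 3 c\<close>; the second one gives \<open>3 a < 1\<close> and, for \<open>b = 1\<close>, \<open>c \<le> a < 1 / 3\<close>.
\<close>
lemma condition_B_limits:
  assumes B: "condition_B L ak bk \<gamma>k"
    and bk: "\<And>k. 0 \<le> bk k" and c: "\<And>k. 0 \<le> \<gamma>k k * L / 2" "\<And>k. \<gamma>k k * L / 2 \<le> 1"
    and lim: "ak \<longlonglongrightarrow> a" "bk \<longlonglongrightarrow> b" "\<gamma>k \<longlonglongrightarrow> \<gamma>"
    and range: "0 \<le> b" "b \<le> 1" "0 \<le> \<gamma> * L" "\<gamma> * L < 2"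
  shows "a < 1" and "b = 1 \<Longrightarrow> \<gamma> * L < 2 / 3"
proof -
  define C where "C k = \<gamma>k k * L / 2" for k
  define c where "c = \<gamma> * L / 2"
  have C: "C \<longlonglongrightarrow> c" unfolding C_def c_def by (intro tendsto_intros lim) simp
  have c01: "0 \<le> c" "c < 1" using range by (auto simp: c_def)
  have cb: "0 \<le> c * b" "c * b \<le> c" "c * b \<le> b"
    using c01 range by (auto intro: mult_left_le mult_left_le_one_le)
  obtain \<tau> where \<tau>: "0 < \<tau>" and
    cases: "(\<forall>k. \<tau> < (1 + ak k) - C k * (1 + bk k)\<^sup>2 \<and> ak k < C k * bk k) \<or>
      (\<forall>k. \<tau> < (1 - 3 * ak k) - C k * (1 - bk k)\<^sup>2 \<and>
           (bk k \<le> ak k \<or> (C k * bk k \<le> ak k \<and> ak k < bk k)))"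
    using B unfolding condition_B_def C_def by blast
  have "a < 1 \<and> (b = 1 \<longrightarrow> c < 1 / 3)"
    using cases
  proof
    assume *: "\<forall>k. \<tau> < (1 + ak k) - C k * (1 + bk k)\<^sup>2 \<and> ak k < C k * bk k"
    have "(\<lambda>k. (1 + ak k) - C k * (1 + bk k)\<^sup>2) \<longlonglongrightarrow> (1 + a) - c * (1 + b)\<^sup>2"
      by (intro tendsto_intros lim C)
    then have "\<tau> \<le> (1 + a) - c * (1 + b)\<^sup>2"
      by (rule LIMSEQ_le_const) (use * in \<open>auto intro: less_imp_le\<close>)
    moreover have "a \<le> c * b"
      by (rule LIMSEQ_le[OF lim(1) tendsto_mult[OF C lim(2)]]) (use * in \<open>auto intro: less_imp_le\<close>)
    ultimately show ?thesis using cb c01 \<tau> by auto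
  next
    assume *: "\<forall>k. \<tau> < (1 - 3 * ak k) - C k * (1 - bk k)\<^sup>2 \<and>
           (bk k \<le> ak k \<or> (C k * bk k \<le> ak k \<and> ak k < bk k))"
    have "(\<lambda>k. (1 - 3 * ak k) - C k * (1 - bk k)\<^sup>2) \<longlonglongrightarrow> (1 - 3 * a) - c * (1 - b)\<^sup>2"
      by (intro tendsto_intros lim C)
    then have "\<tau> \<le> (1 - 3 * a) - c * (1 - b)\<^sup>2"
      by (rule LIMSEQ_le_const) (use * in \<open>auto intro: less_imp_le\<close>)
    moreover have "0 \<le> c * (1 - b)\<^sup>2" using c01 by simp
    moreover have "C k * bk k \<le> ak k" for k
    proof -
      have "C k * bk k \<le> bk k" using bk[of k] c[of k] by (simp only: C_def mult_left_le_one_le)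
      then show ?thesis using * by (meson order_trans)
    qed
    then have "c * b \<le> a"
      by (intro LIMSEQ_le[OF tendsto_mult[OF C lim(2)] lim(1)]) auto
    ultimately show ?thesis using \<tau> by auto
  qed
  then show "a < 1" "b = 1 \<Longrightarrow> \<gamma> * L < 2 / 3" by (auto simp: c_def)
qed

section \<open>Convergence of the inertial iterates\<close>

lemma abs_inner_le_half_sum_squares:
  fixes v w :: "'a::real_inner"
  shows "\<bar>v \<bullet> w\<bar> \<le> (v \<bullet> v + w \<bullet> w) / 2"
proof -
  have "0 \<le> (v + w) \<bullet> (v + w)" "0 \<le> (v - w) \<bullet> (v - w)" by (rule inner_ge_zero)+
  then show ?thesis by (simp add: inner_add inner_diff inner_commute)
qed

text \<open>
  The descent lemma at the gradient point \<open>y = x + b d\<close> bounds \<open>g x'\<close> from above, convexity bounds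
  \<open>g x\<close> from below by the same linearization, and \<open>\<gamma> G y = a d - d'\<close> replaces the gradient by
  the old and the new increment. The mixed term \<open>d \<bullet> d'\<close> is split evenly between the two squares.
\<close>
lemma inertial_step_decrease:
  fixes g :: "'a::real_inner \<Rightarrow> real"
  assumes grad: "\<And>x. GDERIV g x :> G x"
    and convex: "\<And>x y. g x + G x \<bullet> (y - x) \<le> g y"
    and lip: "L-lipschitz_on UNIV G" and \<gamma>: "0 < \<gamma>"
  defines "c \<equiv> \<gamma> * L / 2"
  assumes step: "x' = x + a *\<^sub>R d - \<gamma> *\<^sub>R G (x + b *\<^sub>R d)"
  shows "\<gamma> * (g x' - g x) \<le> (c * b\<^sup>2 + \<bar>a - 2 * c * b\<bar> / 2) * (d \<bullet> d)
    - (1 - c - \<bar>a - 2 * c * b\<bar> / 2) * ((x' - x) \<bullet> (x' - x))"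
proof -
  define y where "y = x + b *\<^sub>R d"
  define d' where "d' = x' - x"
  have x': "x' = x + d'" by (simp add: d'_def)
  have Gy: "\<gamma> *\<^sub>R G y = a *\<^sub>R d - d'" using step by (simp add: y_def d'_def)
  have "g x' \<le> g y + G y \<bullet> (x' - y) + L / 2 * (norm (x' - y))\<^sup>2"
    by (rule descent_lemma[OF grad lip])
  moreover have "g y + G y \<bullet> (x - y) \<le> g x" by (rule convex)
  ultimately have "g x' - g x \<le> G y \<bullet> d' + L / 2 * (norm (d' - b *\<^sub>R d))\<^sup>2"
    by (simp add: y_def x' inner_diff_right inner_add_right)
  then have "\<gamma> * (g x' - g x) \<le> \<gamma> * (G y \<bullet> d' + L / 2 * (norm (d' - b *\<^sub>R d))\<^sup>2)"
    using \<gamma> by (intro mult_left_mono) auto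
  also have "\<dots> = (\<gamma> *\<^sub>R G y) \<bullet> d' + c * ((d' - b *\<^sub>R d) \<bullet> (d' - b *\<^sub>R d))"
    by (simp add: c_def power2_norm_eq_inner algebra_simps)
  also have "\<dots> = (a - 2 * c * b) * (d \<bullet> d') + c * b\<^sup>2 * (d \<bullet> d) - (1 - c) * (d' \<bullet> d')"
    unfolding Gy by (simp add: inner_diff inner_commute power2_eq_square algebra_simps)
  also have "(a - 2 * c * b) * (d \<bullet> d') \<le> \<bar>a - 2 * c * b\<bar> * ((d \<bullet> d + d' \<bullet> d') / 2)"
  proof -
    have "(a - 2 * c * b) * (d \<bullet> d') \<le> \<bar>a - 2 * c * b\<bar> * \<bar>d \<bullet> d'\<bar>"
      by (metis abs_ge_self abs_mult)
    also have "\<dots> \<le> \<bar>a - 2 * c * b\<bar> * ((d \<bullet> d + d' \<bullet> d') / 2)"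
      by (intro mult_left_mono abs_inner_le_half_sum_squares) simp
    finally show ?thesis .
  qed
  finally show ?thesis by (simp add: d'_def[symmetric] field_simps)
qed

text \<open>
  The energy \<open>E k = g (u k) + q k / \<gamma> k * |d k|\<^sup>2\<close> with \<open>d k = u k - u (k - 1)\<close> eventually decreases by
  at least a fixed multiple of \<open>|d (k + 1)|\<^sup>2\<close>: the coefficients of the single-step estimate vary with
  \<open>k\<close>, but they converge, and the limiting gap is positive. Since the energy is bounded below by the
  minimum, the increments tend to zero. Then the gradients at the extrapolated points tend to zero by
  the iteration rule, and strong convexity turns small gradients into closeness to the minimizer.
\<close>
lemma inertial_iterates_converge:
  fixes g :: "'a::real_inner \<Rightarrow> real"
  assumes grad: "\<And>x. GDERIV g x :> G x" and conv: "strongly_convex_with \<mu> g"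
    and lip: "L-lipschitz_on UNIV G" and L: "0 < L"
    and z: "G z = 0"
    and iter: "inertial_iteration G ak bk \<gamma>k u"
    and bk: "\<And>k. 0 \<le> bk k" and \<gamma>k: "\<And>k. \<gamma>k k \<in> {0<..<2 / L}"
    and B: "condition_B L ak bk \<gamma>k"
    and lim: "ak \<longlonglongrightarrow> a" "bk \<longlonglongrightarrow> b" "\<gamma>k \<longlonglongrightarrow> \<gamma>" and \<gamma>: "0 < \<gamma>"
  shows "u \<longlonglongrightarrow> z"
proof -
  define d where "d k = u k - u (k - 1)" for k
  define y where "y k = u k + bk k *\<^sub>R d k" for k
  have step: "u (Suc k) = u k + ak k *\<^sub>R d k - \<gamma>k k *\<^sub>R G (y k)" for k
    using iter by (simp add: inertial_iteration_def Let_def d_def y_def)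
  have mu: "0 < \<mu>" using conv by (simp add: strongly_convex_with_def)
  have \<gamma>k': "0 < \<gamma>k k" "0 \<le> \<gamma>k k * L / 2" "\<gamma>k k * L / 2 \<le> 1" for k
    using \<gamma>k[of k] L by (auto simp: field_simps)
  have convex: "g v + G v \<bullet> (w - v) \<le> g w" for v w
    using strongly_convex_first_order[OF grad conv, of v w] mu
    by (smt (verit) divide_pos_pos mult_nonneg_nonneg zero_le_power2)
  define c where "c k = \<gamma>k k * L / 2" for k
  define p where "p k = 1 - c k - \<bar>ak k - 2 * c k * bk k\<bar> / 2" for k
  define q where "q k = c k * (bk k)\<^sup>2 + \<bar>ak k - 2 * c k * bk k\<bar> / 2" for k
  define w where "w k = d k \<bullet> d k" for k
  have q: "0 \<le> q k" for k using \<gamma>k' by (simp add: q_def c_def)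
  have decrease: "g (u (Suc k)) - g (u k) \<le> q k / \<gamma>k k * w k - p k / \<gamma>k k * w (Suc k)" for k
  proof -
    have "\<gamma>k k * (g (u (Suc k)) - g (u k)) \<le> q k * w k - p k * w (Suc k)"
      using inertial_step_decrease[OF grad convex lip \<gamma>k'(1) step[of k, unfolded y_def]]
      by (simp add: q_def p_def w_def c_def d_def[of "Suc k"])
    then show ?thesis using \<gamma>k'(1)[of k] by (simp add: field_simps)
  qed
  obtain \<tau> where \<tau>: "0 < \<tau>" and gap: "\<And>k. \<tau> \<le> p k - q k"
  proof (rule condition_B_gap[OF B bk \<gamma>k'(2,3)])
    fix \<tau> assume "0 < \<tau>"
      "\<And>k. \<tau> \<le> 1 - \<gamma>k k * L / 2 - \<bar>ak k - 2 * (\<gamma>k k * L / 2) * bk k\<bar> - \<gamma>k k * L / 2 * (bk k)\<^sup>2"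
    then show thesis by (intro that[of \<tau>]) (auto simp: p_def q_def c_def algebra_simps)
  qed
  define pl where "pl = 1 - \<gamma> * L / 2 - \<bar>a - 2 * (\<gamma> * L / 2) * b\<bar> / 2"
  define ql where "ql = \<gamma> * L / 2 * b\<^sup>2 + \<bar>a - 2 * (\<gamma> * L / 2) * b\<bar> / 2"
  have pl: "p \<longlonglongrightarrow> pl" unfolding p_def c_def pl_def by (intro tendsto_intros lim) auto
  have ql: "q \<longlonglongrightarrow> ql" unfolding q_def c_def ql_def by (intro tendsto_intros lim) auto
  have "\<tau> \<le> pl - ql"
    by (rule LIMSEQ_le_const[OF tendsto_diff[OF pl ql]]) (use gap in auto)
  then have pos: "0 < pl / \<gamma> - ql / \<gamma>" using \<tau> \<gamma> by (simp add: diff_divide_distrib[symmetric])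
  obtain \<delta> where \<delta>: "0 < \<delta>" and \<delta>_less: "\<delta> < pl / \<gamma> - ql / \<gamma>"
    using dense[OF pos] by blast
  have "(\<lambda>k. p k / \<gamma>k k - q (Suc k) / \<gamma>k (Suc k)) \<longlonglongrightarrow> pl / \<gamma> - ql / \<gamma>"
    using \<gamma> by (intro tendsto_intros pl lim LIMSEQ_Suc[OF ql] LIMSEQ_Suc[OF lim(3)]) auto
  from order_tendstoD(1)[OF this \<delta>_less]
  obtain K where K: "\<And>k. K \<le> k \<Longrightarrow> \<delta> < p k / \<gamma>k k - q (Suc k) / \<gamma>k (Suc k)"
    by (auto simp: eventually_sequentially)
  define E where "E k = g (u k) + q k / \<gamma>k k * w k" for k
  have w0: "0 \<le> w k" for k by (simp add: w_def)
  have E_dec: "\<delta> * w (Suc k) \<le> E k - E (Suc k)" if "K \<le> k" for k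
  proof -
    have "\<delta> * w (Suc k) \<le> (p k / \<gamma>k k - q (Suc k) / \<gamma>k (Suc k)) * w (Suc k)"
      using K[OF that] w0 by (intro mult_right_mono) auto
    then show ?thesis using decrease[of k] by (simp add: E_def left_diff_distrib)
  qed
  have "decseq (\<lambda>j. E (K + j))"
  proof (rule decseq_SucI)
    fix j
    have "0 \<le> \<delta> * w (Suc (K + j))" using \<delta> w0 by simp
    then show "E (K + Suc j) \<le> E (K + j)" using E_dec[of "K + j"] by simp
  qed
  moreover have "\<forall>j. g z \<le> E (K + j)"
  proof
    fix j
    have "g z \<le> g (u (K + j))" using convex[of z "u (K + j)"] z by simp
    moreover have "0 \<le> q (K + j) / \<gamma>k (K + j) * w (K + j)"
      using q w0 \<gamma>k'(1)[of "K + j"] by (intro mult_nonneg_nonneg divide_nonneg_pos) auto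
    ultimately show "g z \<le> E (K + j)" by (simp add: E_def)
  qed
  ultimately obtain El where El: "(\<lambda>j. E (K + j)) \<longlonglongrightarrow> El"
    by (rule decseq_convergent)
  have "(\<lambda>j. (E (K + j) - E (K + Suc j)) / \<delta>) \<longlonglongrightarrow> (El - El) / \<delta>"
    using \<delta> by (intro tendsto_intros El LIMSEQ_Suc[OF El]) auto
  then have "(\<lambda>j. (E (K + j) - E (K + Suc j)) / \<delta>) \<longlonglongrightarrow> 0"
    by (simp only: diff_self div_0)
  then have "(\<lambda>j. w (Suc (K + j))) \<longlonglongrightarrow> 0"
  proof (rule real_tendsto_sandwich[rotated 3, where f = "\<lambda>_. 0"])
    have "w (Suc (K + j)) \<le> (E (K + j) - E (K + Suc j)) / \<delta>" for j
      using E_dec[of "K + j"] \<delta> by (simp add: pos_le_divide_eq mult.commute)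
    then show "\<forall>\<^sub>F j in sequentially. w (Suc (K + j)) \<le> (E (K + j) - E (K + Suc j)) / \<delta>" by simp
  qed (use w0 in auto)
  then have "(\<lambda>j. w (j + Suc K)) \<longlonglongrightarrow> 0" by (simp add: add.commute)
  then have "w \<longlonglongrightarrow> 0" by (rule LIMSEQ_offset)
  then have "(\<lambda>k. sqrt (w k)) \<longlonglongrightarrow> sqrt 0" by (rule tendsto_real_sqrt)
  then have d0: "d \<longlonglongrightarrow> 0"
    unfolding w_def norm_eq_sqrt_inner[symmetric] real_sqrt_zero by (rule tendsto_norm_zero_cancel)
  have Gy: "G (y k) = (ak k *\<^sub>R d k - d (Suc k)) /\<^sub>R \<gamma>k k" for k
    using step[of k] \<gamma>k'(1)[of k] by (simp add: d_def[of "Suc k"] )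
  have "(\<lambda>k. (ak k *\<^sub>R d k - d (Suc k)) /\<^sub>R \<gamma>k k) \<longlonglongrightarrow> (a *\<^sub>R 0 - 0) /\<^sub>R \<gamma>"
    using \<gamma> by (intro tendsto_intros lim d0 LIMSEQ_Suc[OF d0]) auto
  then have "(\<lambda>k. norm (G (y k))) \<longlonglongrightarrow> 0" unfolding Gy by (intro tendsto_norm_zero) simp
  then have "(\<lambda>k. norm (G (y k)) / \<mu>) \<longlonglongrightarrow> 0" by (rule tendsto_divide_zero)
  then have "(\<lambda>k. norm (y k - z)) \<longlonglongrightarrow> 0"
  proof (rule real_tendsto_sandwich[rotated 3, where f = "\<lambda>_. 0"])
    have "norm (y k - z) \<le> norm (G (y k)) / \<mu>" for k
      using strongly_convex_monotone(2)[OF grad conv, of "y k" z] z mu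
      by (simp add: pos_le_divide_eq mult.commute)
    then show "\<forall>\<^sub>F k in sequentially. norm (y k - z) \<le> norm (G (y k)) / \<mu>" by simp
  qed auto
  then have "y \<longlonglongrightarrow> z" by (simp add: LIM_zero_iff tendsto_norm_zero_iff)
  then have "(\<lambda>k. y k - bk k *\<^sub>R d k) \<longlonglongrightarrow> z - b *\<^sub>R 0" by (intro tendsto_intros lim d0)
  then show ?thesis by (simp add: y_def)
qed

section \<open>Differentiability of the gradient and of the minimizer\<close>

text \<open>
  The Riesz representation \<open>\<Phi>\<close> of the partial derivative in the first argument is a bounded linear
  function of the total derivative, so the gradient inherits joint continuous differentiability.
\<close>
lemma C2_on_imp_C1_gradient:
  fixes f :: "'a::euclidean_space \<Rightarrow> 'p::euclidean_space \<Rightarrow> real"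
  assumes f: "C2_on (UNIV \<times> \<Theta>) (\<lambda>(u, \<theta>). f u \<theta>)" and op: "open \<Theta>"
  obtains F' :: "'a \<times> 'p \<Rightarrow> ('a \<times> 'p) \<Rightarrow>\<^sub>L 'a"
  where "\<And>u \<theta>. \<theta> \<in> \<Theta> \<Longrightarrow> GDERIV (\<lambda>u. f u \<theta>) u :> grad_x f u \<theta>"
    and "\<And>u \<theta>. \<theta> \<in> \<Theta> \<Longrightarrow> ((\<lambda>(u, \<theta>). grad_x f u \<theta>) has_derivative F' (u, \<theta>)) (at (u, \<theta>))"
    and "continuous_on (UNIV \<times> \<Theta>) F'"
proof -
  obtain f' :: "'a \<times> 'p \<Rightarrow> ('a \<times> 'p) \<Rightarrow>\<^sub>L real"
    where f': "\<And>z. z \<in> UNIV \<times> \<Theta> \<Longrightarrow> ((\<lambda>(u, \<theta>). f u \<theta>) has_derivative f' z) (at z)"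
      and C1: "C1_on (UNIV \<times> \<Theta>) f'"
    using f by (auto simp: C2_on_def)
  obtain f'' :: "'a \<times> 'p \<Rightarrow> ('a \<times> 'p) \<Rightarrow>\<^sub>L (('a \<times> 'p) \<Rightarrow>\<^sub>L real)"
    where f'': "\<And>z. z \<in> UNIV \<times> \<Theta> \<Longrightarrow> (f' has_derivative f'' z) (at z)"
      and cont: "continuous_on (UNIV \<times> \<Theta>) f''"
    using C1 by (auto simp: C1_on_def)
  define \<Phi> :: "(('a \<times> 'p) \<Rightarrow>\<^sub>L real) \<Rightarrow> 'a" where "\<Phi> l = (\<Sum>i\<in>Basis. l (i, 0) *\<^sub>R i)" for l
  have \<Phi>: "bounded_linear \<Phi>"
    unfolding \<Phi>_def
    by (intro bounded_linear_sum bounded_linear_scaleR_const blinfun.bounded_linear_left)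
  have inner_\<Phi>: "h \<bullet> \<Phi> l = l (h, 0)" for h l
  proof -
    have "l (h, 0) = l (\<Sum>i\<in>Basis. (h \<bullet> i) *\<^sub>R (i, 0))"
      by (rule arg_cong[where f = "blinfun_apply l"])
        (simp add: prod_eq_iff fst_sum snd_sum euclidean_representation)
    also have "\<dots> = (\<Sum>i\<in>Basis. (h \<bullet> i) * l (i, 0))"
      by (simp only: blinfun.sum_right blinfun.scaleR_right real_scaleR_def)
    also have "\<dots> = h \<bullet> \<Phi> l" by (simp add: \<Phi>_def inner_sum_right mult.commute)
    finally show ?thesis by simp
  qed
  have gderiv: "GDERIV (\<lambda>u. f u \<theta>) u :> \<Phi> (f' (u, \<theta>))" if "\<theta> \<in> \<Theta>" for u \<theta>
  proof -
    have "((\<lambda>u. (u, \<theta>)) has_derivative (\<lambda>h. (h, 0))) (at u)"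
      by (auto intro!: derivative_eq_intros)
    from has_derivative_compose[OF this f'[of "(u, \<theta>)"]] that
    show ?thesis by (simp add: gderiv_def inner_\<Phi>)
  qed
  have grad_eq: "grad_x f u \<theta> = \<Phi> (f' (u, \<theta>))" if "\<theta> \<in> \<Theta>" for u \<theta>
    unfolding grad_x_def grad_def
  proof (rule the_equality)
    show "GDERIV (\<lambda>u. f u \<theta>) u :> \<Phi> (f' (u, \<theta>))" using that by (rule gderiv)
    fix D assume D: "GDERIV (\<lambda>u. f u \<theta>) u :> D"
    have "(\<lambda>h. h \<bullet> D) = (\<lambda>h. h \<bullet> \<Phi> (f' (u, \<theta>)))"
      using D gderiv[OF that, of u] unfolding gderiv_def by (rule has_derivative_unique)
    then show "D = \<Phi> (f' (u, \<theta>))" unfolding fun_eq_iff vector_eq_ldot .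
  qed
  show thesis
  proof (rule that)
    show "GDERIV (\<lambda>u. f u \<theta>) u :> grad_x f u \<theta>" if "\<theta> \<in> \<Theta>" for u \<theta>
      using gderiv[OF that] grad_eq[OF that] by simp
    show "((\<lambda>(u, \<theta>). grad_x f u \<theta>) has_derivative (Blinfun \<Phi> o\<^sub>L f'' (u, \<theta>))) (at (u, \<theta>))"
      if "\<theta> \<in> \<Theta>" for u \<theta>
    proof (rule has_derivative_transform_within_open)
      show "((\<lambda>z. \<Phi> (f' z)) has_derivative blinfun_apply (Blinfun \<Phi> o\<^sub>L f'' (u, \<theta>))) (at (u, \<theta>))"
        using bounded_linear.has_derivative[OF \<Phi> f'', of "(u, \<theta>)", simplified, OF that]
        by (rule has_derivative_eq_rhs) (auto simp: bounded_linear_Blinfun_apply[OF \<Phi>])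
      show "open (UNIV \<times> \<Theta>)" using op by (intro open_Times) auto
    qed (use that grad_eq in auto)
    show "continuous_on (UNIV \<times> \<Theta>) (\<lambda>z. Blinfun \<Phi> o\<^sub>L f'' z)"
      by (intro bounded_bilinear.continuous_on[OF bounded_bilinear_blinfun_compose]
          continuous_on_const cont)
  qed
qed

text \<open>
  A pointwise replacement for the implicit function theorem. The expansion inequality at \<open>\<theta>\<close> compares
  \<open>s t\<close> with \<open>s \<theta>\<close> through \<open>F (s t, \<theta>) = F (s t, \<theta>) - F (s t, t)\<close>, so the zero is Lipschitz at
  \<open>\<theta>\<close>; hence the linearization of \<open>F\<close> at the one point \<open>(s \<theta>, \<theta>)\<close> has an error that is small
  compared with \<open>t - \<theta>\<close>, and the coercive partial derivative transfers it to \<open>s\<close>. The expansion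
  constant is needed only at \<open>\<theta>\<close>: moduli of strong convexity may degenerate along \<open>\<Theta>\<close>.
\<close>
lemma parametrized_zero_has_derivative:
  fixes F :: "'a::euclidean_space \<times> 'p::real_normed_vector \<Rightarrow> 'a"
  assumes op: "open \<Theta>" and \<theta>: "\<theta> \<in> \<Theta>"
    and zero: "\<And>t. t \<in> \<Theta> \<Longrightarrow> F (s t, t) = 0"
    and K: "(F has_derivative K) (at (s \<theta>, \<theta>))"
    and \<mu>: "0 < \<mu>"
    and expand: "\<And>y z. \<mu> * norm (y - z) \<le> norm (F (y, \<theta>) - F (z, \<theta>))"
    and lip: "\<And>u t. t \<in> \<Theta> \<Longrightarrow> norm (F (u, t) - F (u, \<theta>)) \<le> L * norm (t - \<theta>)"
    and coercive: "\<And>v. \<mu> * norm v \<le> norm (K (v, 0))"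
  obtains S where "(s has_derivative S) (at \<theta>)" "\<And>h. K (S h, h) = 0"
proof -
  interpret K: bounded_linear K using K by (rule has_derivative_bounded_linear)
  have lin: "linear (\<lambda>v. K (v, 0))"
    by (rule linearI) (simp_all flip: K.add K.scaleR)
  moreover have "inj (\<lambda>v. K (v, 0))"
    unfolding linear_injective_0[OF lin]
  proof (intro allI impI)
    fix v assume "K (v, 0) = 0"
    then have "\<mu> * norm v \<le> 0" using coercive[of v] by simp
    then show "v = 0" using \<mu> by (simp add: mult_le_0_iff)
  qed
  ultimately obtain R where R: "linear R" "\<And>v. K (R v, 0) = v"
    using linear_injective_isomorphism[of "\<lambda>v. K (v, 0)"] by auto
  define S where "S h = - R (K (0, h))" for h
  have "bounded_linear (\<lambda>h. R (K (0, h)))"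
    by (intro bounded_linear_compose[OF linear_conv_bounded_linear[THEN iffD1, OF R(1)]]
        bounded_linear_compose[OF K.bounded_linear_axioms] bounded_linear_Pair
        bounded_linear_zero bounded_linear_ident)
  then have S: "bounded_linear S" unfolding S_def by (rule bounded_linear_minus)
  have KS: "K (S h, h) = 0" for h
  proof -
    have "K (S h, h) = K (0, h) - K (R (K (0, h)), 0)"
      by (simp add: S_def flip: K.diff)
    then show ?thesis by (simp add: R(2))
  qed
  have s_lip: "norm (s t - s \<theta>) \<le> L / \<mu> * norm (t - \<theta>)" if t: "t \<in> \<Theta>" for t
  proof -
    have "\<mu> * norm (s t - s \<theta>) \<le> norm (F (s t, \<theta>) - F (s \<theta>, \<theta>))" by (rule expand)
    also have "\<dots> = norm (F (s t, t) - F (s t, \<theta>))"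
      using zero[OF t] zero[OF \<theta>] by (simp add: norm_minus_commute)
    also have "\<dots> \<le> L * norm (t - \<theta>)" using t by (rule lip)
    finally show ?thesis using \<mu> by (simp add: field_simps)
  qed
  define c where "c = (\<bar>L\<bar> / \<mu> + 1)"
  have c: "0 < c" unfolding c_def using \<mu> by (intro add_nonneg_pos) auto
  have \<Delta>: "norm ((s t, t) - (s \<theta>, \<theta>)) \<le> c * norm (t - \<theta>)" if t: "t \<in> \<Theta>" for t
  proof -
    have "norm ((s t, t) - (s \<theta>, \<theta>)) \<le> norm (s t - s \<theta>) + norm (t - \<theta>)"
      by (simp add: norm_Pair_le)
    also have "\<dots> \<le> \<bar>L\<bar> / \<mu> * norm (t - \<theta>) + norm (t - \<theta>)"
      using s_lip[OF t] \<mu> by (intro add_right_mono order_trans[OF s_lip[OF t]] mult_right_mono divide_right_mono) auto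
    finally show ?thesis by (simp add: c_def algebra_simps)
  qed
  have "(s has_derivative S) (at \<theta>)"
    unfolding has_derivative_at_alt
  proof (intro conjI allI impI S)
    fix e :: real assume e: "0 < e"
    then have "0 < e * \<mu> / c" using \<mu> c by simp
    then obtain d where d: "0 < d" "\<And>y. norm (y - (s \<theta>, \<theta>)) < d \<Longrightarrow>
        norm (F y - F (s \<theta>, \<theta>) - K (y - (s \<theta>, \<theta>))) \<le> e * \<mu> / c * norm (y - (s \<theta>, \<theta>))"
      using K[unfolded has_derivative_at_alt] by blast
    obtain d' where d': "0 < d'" "\<And>t. dist t \<theta> < d' \<Longrightarrow> t \<in> \<Theta>"
      using op \<theta> by (meson open_dist)
    show "\<exists>d>0. \<forall>t. norm (t - \<theta>) < d \<longrightarrow> norm (s t - s \<theta> - S (t - \<theta>)) \<le> e * norm (t - \<theta>)"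
    proof (intro exI conjI allI impI)
      show "0 < min d' (d / c)" using d d' c by simp
      fix t assume "norm (t - \<theta>) < min d' (d / c)"
      then have t: "t \<in> \<Theta>" and td: "c * norm (t - \<theta>) < d"
        using d' c by (auto simp: dist_norm field_simps)
      let ?\<Delta> = "(s t, t) - (s \<theta>, \<theta>)" and ?h = "t - \<theta>"
      have "K (s t - s \<theta> - S ?h, 0) = K ?\<Delta> - K (S ?h, ?h)" by (simp flip: K.diff)
      also have "\<dots> = - (F (s t, t) - F (s \<theta>, \<theta>) - K ?\<Delta>)" by (simp add: zero t \<theta> KS)
      finally have "norm (K (s t - s \<theta> - S ?h, 0)) \<le> e * \<mu> / c * norm ?\<Delta>"
        using d(2)[of "(s t, t)"] \<Delta>[OF t] td by (simp only: norm_minus_cancel)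
      also have "\<dots> \<le> e * \<mu> / c * (c * norm ?h)"
        using e \<mu> c by (intro mult_left_mono \<Delta> t) auto
      finally have "\<mu> * norm (s t - s \<theta> - S ?h) \<le> \<mu> * (e * norm ?h)"
        using coercive[of "s t - s \<theta> - S ?h"] c by (simp add: mult_ac)
      then show "norm (s t - s \<theta> - S ?h) \<le> e * norm ?h" using \<mu> by simp
    qed
  qed
  then show thesis using KS by (rule that)
qed

section \<open>Derivatives of the inertial iterates\<close>

lemma inertial_step_has_derivative:
  fixes F :: "'a::real_normed_vector \<times> 'p::real_normed_vector \<Rightarrow> 'a"
  assumes op: "open \<Theta>" and \<theta>: "\<theta> \<in> \<Theta>"
    and iter: "\<And>t. t \<in> \<Theta> \<Longrightarrow> inertial_iteration (\<lambda>u. F (u, t)) a b \<gamma> (\<lambda>k. x k t)"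
    and D: "(x k has_derivative D) (at \<theta>)" and E: "(x (k - 1) has_derivative E) (at \<theta>)"
    and K: "(F has_derivative K) (at (x k \<theta> + b k *\<^sub>R (x k \<theta> - x (k - 1) \<theta>), \<theta>))"
  shows "(x (Suc k) has_derivative
    (\<lambda>h. D h + a k *\<^sub>R (D h - E h) - \<gamma> k *\<^sub>R K (D h + b k *\<^sub>R (D h - E h), h))) (at \<theta>)"
proof (rule has_derivative_transform_within_open[OF _ op \<theta>])
  have y: "((\<lambda>t. (x k t + b k *\<^sub>R (x k t - x (k - 1) t), t))
      has_derivative (\<lambda>h. (D h + b k *\<^sub>R (D h - E h), h))) (at \<theta>)"
    by (intro derivative_intros D E)
  show "((\<lambda>t. x k t + a k *\<^sub>R (x k t - x (k - 1) t)
      - \<gamma> k *\<^sub>R F (x k t + b k *\<^sub>R (x k t - x (k - 1) t), t)) has_derivative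
    (\<lambda>h. D h + a k *\<^sub>R (D h - E h) - \<gamma> k *\<^sub>R K (D h + b k *\<^sub>R (D h - E h), h))) (at \<theta>)"
    by (intro has_derivative_diff has_derivative_add has_derivative_scaleR_right
        has_derivative_compose[OF y K] D E)
  fix t assume "t \<in> \<Theta>"
  then show "x k t + a k *\<^sub>R (x k t - x (k - 1) t)
      - \<gamma> k *\<^sub>R F (x k t + b k *\<^sub>R (x k t - x (k - 1) t), t) = x (Suc k) t"
    using iter[of t] by (simp add: inertial_iteration_def Let_def)
qed

lemma inertial_iterates_has_derivative:
  fixes F :: "'a::real_normed_vector \<times> 'p::real_normed_vector \<Rightarrow> 'a"
  assumes op: "open \<Theta>" and \<theta>: "\<theta> \<in> \<Theta>"
    and iter: "\<And>t. t \<in> \<Theta> \<Longrightarrow> inertial_iteration (\<lambda>u. F (u, t)) a b \<gamma> (\<lambda>k. x k t)"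
    and F': "\<And>u. (F has_derivative F' u) (at (u, \<theta>))"
    and x0: "x 0 differentiable (at \<theta>)"
  obtains D where "\<And>k. (x k has_derivative D k) (at \<theta>)"
    and "\<And>k h. D (Suc k) h = D k h + a k *\<^sub>R (D k h - D (k - 1) h)
      - \<gamma> k *\<^sub>R F' (x k \<theta> + b k *\<^sub>R (x k \<theta> - x (k - 1) \<theta>)) (D k h + b k *\<^sub>R (D k h - D (k - 1) h), h)"
proof -
  have step: "(x (Suc k) has_derivative (\<lambda>h. D h + a k *\<^sub>R (D h - E h)
      - \<gamma> k *\<^sub>R F' (x k \<theta> + b k *\<^sub>R (x k \<theta> - x (k - 1) \<theta>)) (D h + b k *\<^sub>R (D h - E h), h))) (at \<theta>)"
    if "(x k has_derivative D) (at \<theta>)" "(x (k - 1) has_derivative E) (at \<theta>)" for k D E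
    by (rule inertial_step_has_derivative[OF op \<theta> _ that F']) (rule iter)
  have "x k differentiable (at \<theta>)" for k
  proof (induction k rule: less_induct)
    case (less k)
    show ?case
    proof (cases k)
      case (Suc j)
      have "x j differentiable (at \<theta>)" "x (j - 1) differentiable (at \<theta>)"
        using less Suc by auto
      then show ?thesis unfolding differentiable_def Suc using step by blast
    qed (use x0 in simp)
  qed
  then have der: "(x k has_derivative frechet_derivative (x k) (at \<theta>)) (at \<theta>)" for k
    by (simp add: frechet_derivative_works)
  show thesis
  proof (rule that[OF der])
    fix k h
    show "frechet_derivative (x (Suc k)) (at \<theta>) h
      = frechet_derivative (x k) (at \<theta>) h
        + a k *\<^sub>R (frechet_derivative (x k) (at \<theta>) h - frechet_derivative (x (k - 1)) (at \<theta>) h)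
        - \<gamma> k *\<^sub>R F' (x k \<theta> + b k *\<^sub>R (x k \<theta> - x (k - 1) \<theta>))
            (frechet_derivative (x k) (at \<theta>) h
              + b k *\<^sub>R (frechet_derivative (x k) (at \<theta>) h - frechet_derivative (x (k - 1)) (at \<theta>) h), h)"
      using has_derivative_unique[OF der step[OF der der]] by metis
  qed
qed

text \<open>
  Differentiating the iteration rule in the direction \<open>h\<close> gives a linear recursion for \<open>z k\<close> whose
  coefficients converge and whose limiting recursion has the fixed point \<open>w\<close>. With
  \<open>H v = K (v, 0)\<close>, the limiting recursion for the error is \<open>z\<^sub>k\<^sub>+\<^sub>1 = T z\<^sub>k - D z\<^sub>k\<^sub>-\<^sub>1\<close> for
  \<open>T = (1 + a) - \<gamma> (1 + b) H\<close> and \<open>D = a - \<gamma> b H\<close>. The three operators that have to be positive are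
  \<open>1 + D - T = \<gamma> H\<close>, \<open>1 - D = (1 - a) + \<gamma> b H\<close>, and
  \<open>1 + D + T = 2 + 2 a - \<gamma> (1 + 2 b) H\<close>; the last one is the assumption on \<open>\<kappa>\<close>.
\<close>
lemma linearized_inertial_iteration_converges:
  fixes Kk :: "nat \<Rightarrow> ('a::real_inner \<times> 'p::real_normed_vector) \<Rightarrow>\<^sub>L 'a" and z :: "nat \<Rightarrow> 'a"
  assumes step: "\<And>k. z (Suc k) = z k + ak k *\<^sub>R (z k - z (k - 1))
      - \<gamma>k k *\<^sub>R Kk k (z k + bk k *\<^sub>R (z k - z (k - 1)), h)"
    and lim: "ak \<longlonglongrightarrow> a" "bk \<longlonglongrightarrow> b" "\<gamma>k \<longlonglongrightarrow> \<gamma>" "Kk \<longlonglongrightarrow> K"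
    and fixpoint: "K (w, h) = 0"
    and sym: "\<And>u v. K (u, 0) \<bullet> v = u \<bullet> K (v, 0)"
    and \<mu>: "0 < \<mu>" "\<And>v. \<mu> * (v \<bullet> v) \<le> v \<bullet> K (v, 0)"
    and ab: "a < 1" "0 \<le> b" and \<gamma>: "0 < \<gamma>"
    and \<kappa>: "0 < \<kappa>" "\<And>v. \<gamma> * (1 + 2 * b) * (v \<bullet> K (v, 0)) \<le> (2 + 2 * a - \<kappa>) * (v \<bullet> v)"
  shows "z \<longlonglongrightarrow> w"
proof -
  define H where "H v = K (v, 0)" for v
  have H: "bounded_linear H"
    unfolding H_def by (intro blinfun.bounded_linear_right bounded_linear_compose[OF blinfun.bounded_linear_right]
        bounded_linear_Pair bounded_linear_zero bounded_linear_ident)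
  interpret H: bounded_linear H by (rule H)
  define T where "T v = (1 + a) *\<^sub>R v - (\<gamma> * (1 + b)) *\<^sub>R H v" for v
  define D where "D v = a *\<^sub>R v - (\<gamma> * b) *\<^sub>R H v" for v
  have T: "bounded_linear T"
    unfolding T_def by (intro bounded_linear_sub bounded_linear_const_scaleR bounded_linear_ident H)
  have D: "bounded_linear D"
    unfolding D_def by (intro bounded_linear_sub bounded_linear_const_scaleR bounded_linear_ident H)
  define A where "A = (\<lambda>(u, w). (T u - D w, u))"
  have A: "bounded_linear A"
    unfolding A_def case_prod_beta
    by (intro bounded_linear_Pair bounded_linear_sub bounded_linear_compose[OF T] bounded_linear_compose[OF D]
        bounded_linear_fst bounded_linear_snd)
  define p where "p = min (\<gamma> * \<mu>) (min \<kappa> (1 - a))"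
  have p: "0 < p" "p \<le> \<gamma> * \<mu>" "p \<le> \<kappa>" "p \<le> 1 - a" using \<gamma> \<mu> \<kappa> ab by (auto simp: p_def)
  have p_le: "p * (v \<bullet> v) \<le> c * (v \<bullet> v)" if "p \<le> c" for c v
    using that by (intro mult_right_mono) auto
  have vHv: "0 \<le> v \<bullet> H v" for v
    using \<mu> order_trans[OF mult_nonneg_nonneg[of \<mu> "v \<bullet> v"]] by (fastforce simp: H_def)
  obtain m where m: "0 < m" "\<And>y. norm ((A ^^ m) y) \<le> norm y / 2"
  proof (rule two_term_recursion_power_halves[OF T D _ _ p(1), folded A_def])
    show "T u \<bullet> v = u \<bullet> T v" "D u \<bullet> v = u \<bullet> D v" for u v
      using sym by (auto simp: T_def D_def H_def inner_simps)
    show "p * (v \<bullet> v) \<le> v \<bullet> (v + D v - T v)" for v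
    proof -
      have "p * (v \<bullet> v) \<le> \<gamma> * (\<mu> * (v \<bullet> v))" using p_le[OF p(2)] by (simp add: mult.assoc)
      also have "\<dots> \<le> \<gamma> * (v \<bullet> H v)" using \<mu> \<gamma> by (simp add: H_def)
      also have "\<dots> = v \<bullet> (v + D v - T v)" by (simp add: T_def D_def inner_simps algebra_simps)
      finally show ?thesis .
    qed
    show "p * (v \<bullet> v) \<le> v \<bullet> (v + D v + T v)" for v
    proof -
      have "v \<bullet> (v + D v + T v) = (2 + 2 * a) * (v \<bullet> v) - \<gamma> * (1 + 2 * b) * (v \<bullet> H v)"
        by (simp add: T_def D_def inner_simps algebra_simps)
      then show ?thesis using \<kappa>(2)[of v] p_le[OF p(3), of v] by (simp add: H_def algebra_simps)
    qed
    show "p * (v \<bullet> v) \<le> v \<bullet> (v - D v)" for v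
    proof -
      have "v \<bullet> (v - D v) = (1 - a) * (v \<bullet> v) + \<gamma> * b * (v \<bullet> H v)"
        by (simp add: D_def inner_simps algebra_simps)
      moreover have "0 \<le> \<gamma> * b * (v \<bullet> H v)" using \<gamma> ab vHv by simp
      ultimately show ?thesis using p_le[OF p(4), of v] by linarith
    qed
  qed (rule that)
  define e where "e k = (z k - w, z (k - 1) - w)" for k
  define c where "c = 1 + norm w + norm h"
  define \<epsilon> where "\<epsilon> k = 2 * \<bar>ak k - a\<bar> + \<bar>\<gamma>k k\<bar> * (norm (Kk k - K) * ((1 + 2 * \<bar>bk k\<bar>) + c))
      + (1 + 2 * \<bar>bk k\<bar>) * norm K * \<bar>\<gamma>k k - \<gamma>\<bar> + \<gamma> * norm K * (2 * \<bar>bk k - b\<bar>)" for k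
  have "e \<longlonglongrightarrow> 0"
  proof (rule tendsto_zero_of_perturbed_linear_recursion[OF A m])
    have "\<epsilon> \<longlonglongrightarrow> 2 * \<bar>a - a\<bar> + \<bar>\<gamma>\<bar> * (norm (K - K) * ((1 + 2 * \<bar>b\<bar>) + c))
      + (1 + 2 * \<bar>b\<bar>) * norm K * \<bar>\<gamma> - \<gamma>\<bar> + \<gamma> * norm K * (2 * \<bar>b - b\<bar>)"
      unfolding \<epsilon>_def by (intro tendsto_intros lim)
    then show "\<epsilon> \<longlonglongrightarrow> 0" by simp
    fix k
    define u where "u = z k - w"
    define v where "v = z (k - 1) - w"
    define N where "N = norm (e k)"
    have N: "norm u \<le> N" "norm v \<le> N" "0 \<le> N"
      using norm_fst_le[of u v] norm_snd_le[of v u] by (auto simp: N_def e_def u_def v_def)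
    have uv: "norm (u - v) \<le> 2 * N" using norm_triangle_ineq4[of u v] N by linarith
    define y where "y = u + bk k *\<^sub>R (u - v)"
    have y: "norm y \<le> (1 + 2 * \<bar>bk k\<bar>) * N"
    proof -
      have "norm y \<le> norm u + \<bar>bk k\<bar> * norm (u - v)"
        unfolding y_def using norm_triangle_ineq[of u "bk k *\<^sub>R (u - v)"] by simp
      also have "\<dots> \<le> N + \<bar>bk k\<bar> * (2 * N)" using N uv by (intro add_mono mult_left_mono) auto
      finally show ?thesis by (simp add: algebra_simps)
    qed
    have H_eq: "H y' = K (y' + w, h)" for y'
    proof -
      have "K (y' + w, h) = K ((y', 0) + (w, h))" by simp
      also have "\<dots> = H y'" unfolding blinfun.add_right by (simp add: fixpoint H_def)
      finally show ?thesis by simp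
    qed
    \<comment> \<open>The error of the limiting recursion splits into one part for each of the four quantities
        that have not yet reached their limits.\<close>
    have "z (Suc k) - w - (T u - D v) = (ak k - a) *\<^sub>R (u - v) - \<gamma>k k *\<^sub>R (Kk k - K) (y + w, h)
        - (\<gamma>k k - \<gamma>) *\<^sub>R H y - \<gamma> *\<^sub>R ((bk k - b) *\<^sub>R H (u - v))"
    proof -
      have zz: "z k - z (k - 1) = u - v" by (simp add: u_def v_def)
      have "z k + bk k *\<^sub>R (u - v) = y + w" by (simp add: y_def u_def)
      then have "z (Suc k) = z k + ak k *\<^sub>R (u - v) - \<gamma>k k *\<^sub>R Kk k (y + w, h)"
        using step[of k] unfolding zz by (simp only:)
      then have z': "z (Suc k) - w = u + ak k *\<^sub>R (u - v) - \<gamma>k k *\<^sub>R (Kk k - K) (y + w, h) - \<gamma>k k *\<^sub>R H y"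
        unfolding blinfun.diff_left H_eq[of y] scaleR_diff_right by (simp add: u_def)
      have Hy: "H y = H u + bk k *\<^sub>R (H u - H v)"
        unfolding y_def by (simp only: H.add H.diff H.scaleR)
      show ?thesis
        unfolding z' Hy T_def D_def H.diff by (simp add: algebra_simps)
    qed
    also have "norm \<dots> \<le> norm ((ak k - a) *\<^sub>R (u - v)) + norm (\<gamma>k k *\<^sub>R (Kk k - K) (y + w, h))
        + norm ((\<gamma>k k - \<gamma>) *\<^sub>R H y) + norm (\<gamma> *\<^sub>R ((bk k - b) *\<^sub>R H (u - v)))"
      by (intro order_trans[OF norm_triangle_ineq4] add_mono order_refl)
    also have "\<dots> \<le> \<epsilon> k * (N + 1)"
    proof -
      have 1: "norm ((ak k - a) *\<^sub>R (u - v)) \<le> \<bar>ak k - a\<bar> * (2 * (N + 1))"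
        using uv by (simp add: mult_left_mono)
      have 2: "norm (\<gamma>k k *\<^sub>R (Kk k - K) (y + w, h))
          \<le> \<bar>\<gamma>k k\<bar> * (norm (Kk k - K) * (((1 + 2 * \<bar>bk k\<bar>) + c) * (N + 1)))"
      proof -
        have "norm (y + w, h) \<le> norm y + norm w + norm h"
          using norm_Pair_le[of "y + w" h] norm_triangle_ineq[of y w] by linarith
        also have "\<dots> \<le> (1 + 2 * \<bar>bk k\<bar>) * (N + 1) + c * 1"
          using y by (simp add: c_def algebra_simps)
        also have "\<dots> \<le> (1 + 2 * \<bar>bk k\<bar>) * (N + 1) + c * (N + 1)"
          using N by (intro add_left_mono mult_left_mono) (auto simp: c_def)
        finally have "norm ((Kk k - K) (y + w, h)) \<le> norm (Kk k - K) * (((1 + 2 * \<bar>bk k\<bar>) + c) * (N + 1))"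
          by (intro order_trans[OF norm_blinfun] mult_left_mono) (auto simp: distrib_right)
        then show ?thesis by (simp add: mult_left_mono)
      qed
      have nH: "norm (H v) \<le> norm K * norm v" for v
        using norm_blinfun[of K "(v, 0)"] by (simp add: H_def norm_Pair)
      have 3: "norm ((\<gamma>k k - \<gamma>) *\<^sub>R H y) \<le> \<bar>\<gamma>k k - \<gamma>\<bar> * (norm K * ((1 + 2 * \<bar>bk k\<bar>) * (N + 1)))"
      proof -
        have "norm (H y) \<le> norm K * ((1 + 2 * \<bar>bk k\<bar>) * (N + 1))"
          using y by (intro order_trans[OF nH] mult_left_mono) (auto simp: algebra_simps)
        then show ?thesis by (simp add: mult_left_mono)
      qed
      have 4: "norm (\<gamma> *\<^sub>R ((bk k - b) *\<^sub>R H (u - v))) \<le> \<gamma> * (\<bar>bk k - b\<bar> * (norm K * (2 * (N + 1))))"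
      proof -
        have "norm (H (u - v)) \<le> norm K * (2 * (N + 1))"
          using uv by (intro order_trans[OF nH] mult_left_mono) auto
        then show ?thesis using \<gamma> by (simp add: abs_mult mult.assoc mult_left_mono)
      qed
      have distribute: "(2 * x + g * (n * (B + c)) + B * m * y + l * m * (2 * t)) * M
          = x * (2 * M) + g * (n * ((B + c) * M)) + y * (m * (B * M)) + l * (t * (m * (2 * M)))"
        for x g n B m y l t M :: real by (simp add: algebra_simps)
      have "\<epsilon> k * (N + 1) = \<bar>ak k - a\<bar> * (2 * (N + 1))
          + \<bar>\<gamma>k k\<bar> * (norm (Kk k - K) * (((1 + 2 * \<bar>bk k\<bar>) + c) * (N + 1)))
          + \<bar>\<gamma>k k - \<gamma>\<bar> * (norm K * ((1 + 2 * \<bar>bk k\<bar>) * (N + 1)))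
          + \<gamma> * (\<bar>bk k - b\<bar> * (norm K * (2 * (N + 1))))"
        unfolding \<epsilon>_def by (rule distribute)
      then show ?thesis using add_mono[OF add_mono[OF add_mono[OF 1 2] 3] 4] by (simp only:)
    qed
    finally have est: "norm (z (Suc k) - w - (T u - D v)) \<le> \<epsilon> k * (N + 1)" .
    have "e (Suc k) - A (e k) = (z (Suc k) - w - (T u - D v), 0)"
      by (simp add: e_def A_def u_def v_def)
    then show "norm (e (Suc k) - A (e k)) \<le> \<epsilon> k * (norm (e k) + 1)"
      using est by (simp add: N_def norm_Pair)
  qed
  from tendsto_fst[OF this] have "(\<lambda>k. z k - w) \<longlonglongrightarrow> 0" by (simp add: e_def)
  then show ?thesis by (simp add: LIM_zero_iff)
qed

section \<open>The smallest eigenvalue and the Rayleigh quotient\<close>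

text \<open>
  Eigenvectors of a symmetric matrix for distinct eigenvalues are orthogonal, hence independent.
  Finiteness is what makes the \<^const>\<open>Min\<close> in \<^const>\<open>smallest_eigenvalue\<close> a lower bound.
\<close>
lemma finite_eigenvalues_of_symmetric:
  fixes A :: "real^'n^'n"
  assumes sym: "\<And>u v. (A *v u) \<bullet> v = u \<bullet> (A *v v)"
  shows "finite {l. eigenvalue_of A l}"
proof -
  define e where "e l = (SOME v. v \<noteq> 0 \<and> A *v v = l *\<^sub>R v)" for l
  have e: "e l \<noteq> 0 \<and> A *v e l = l *\<^sub>R e l" if "eigenvalue_of A l" for l
    using that unfolding eigenvalue_of_def e_def by (rule someI_ex)
  let ?S = "{l. eigenvalue_of A l}"
  have orth: "e l \<bullet> e l' = 0" if "l \<in> ?S" "l' \<in> ?S" "l \<noteq> l'" for l l'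
    using sym[of "e l" "e l'"] e[of l] e[of l'] that by auto
  have "inj_on e ?S"
    using orth e by (intro inj_onI) (metis inner_eq_zero_iff mem_Collect_eq)
  moreover have "pairwise orthogonal (e ` ?S)"
    using orth unfolding pairwise_def orthogonal_def by blast
  then have "independent (e ` ?S)"
    using e by (intro pairwise_orthogonal_independent) auto
  then have "finite (e ` ?S)" by (rule finiteI_independent)
  ultimately show ?thesis using finite_imageD by blast
qed

text \<open>
  The Rayleigh quotient attains its minimum \<open>l\<close> on the unit sphere at some \<open>m\<close>. The form of
  \<open>B = A - l\<close> is nonnegative and vanishes at \<open>m\<close>, which forces \<open>B m = 0\<close>: otherwise moving from \<open>m\<close>
  a little against \<open>B m\<close> would make the form negative. So \<open>l\<close> is an eigenvalue.
\<close>
lemma smallest_eigenvalue_le_rayleigh: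
  fixes A :: "real^'n^'n"
  assumes sym: "\<And>u v. (A *v u) \<bullet> v = u \<bullet> (A *v v)"
  shows "smallest_eigenvalue A * (v \<bullet> v) \<le> v \<bullet> (A *v v)"
proof -
  have "continuous_on (sphere 0 1) (\<lambda>v. v \<bullet> (A *v v))"
    by (intro continuous_intros matrix_vector_mult_linear_continuous_on)
  moreover have "sphere (0 :: real^'n) 1 \<noteq> {}" by simp
  ultimately obtain m where m: "norm m = 1" "\<And>v. norm v = 1 \<Longrightarrow> m \<bullet> (A *v m) \<le> v \<bullet> (A *v v)"
    using continuous_attains_inf[OF compact_sphere[of "0 :: real^'n" 1]] by (metis mem_sphere_0)
  define l where "l = m \<bullet> (A *v m)"
  define B where "B v = A *v v - l *\<^sub>R v" for v
  have B_nonneg: "0 \<le> v \<bullet> B v" for v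
  proof (cases "v = 0")
    case False
    have "l \<le> (v /\<^sub>R norm v) \<bullet> (A *v (v /\<^sub>R norm v))"
      unfolding l_def using False by (intro m) simp
    also have "\<dots> = (v \<bullet> (A *v v)) / (norm v)\<^sup>2"
      by (simp add: matrix_vector_mult_scaleR power2_eq_square divide_inverse mult_ac)
    finally have "l * (norm v)\<^sup>2 \<le> v \<bullet> (A *v v)"
      using False by (simp add: pos_le_divide_eq)
    then show ?thesis by (simp add: B_def inner_diff_right power2_norm_eq_inner)
  qed (simp add: B_def)
  have B_sym: "B u \<bullet> v = u \<bullet> B v" for u v
    using sym[of u v] by (simp add: B_def inner_diff_left inner_diff_right)
  have Bm: "m \<bullet> B m = 0"
    using m(1) by (simp add: B_def l_def inner_diff_right dot_square_norm)
  have "B m = 0"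
  proof (rule ccontr)
    assume "B m \<noteq> 0"
    then have pos: "0 < B m \<bullet> B m" by simp
    define c where "c = B m \<bullet> B (B m)"
    have quad: "0 \<le> 2 * t * (B m \<bullet> B m) + t\<^sup>2 * c" for t
    proof -
      have "B (m + t *\<^sub>R B m) = B m + t *\<^sub>R B (B m)"
        by (simp add: B_def matrix_vector_right_distrib matrix_vector_mult_diff_distrib
            matrix_vector_mult_scaleR algebra_simps)
      then have "(m + t *\<^sub>R B m) \<bullet> B (m + t *\<^sub>R B m) = 2 * t * (B m \<bullet> B m) + t\<^sup>2 * c"
        using Bm B_sym[of m "B m"]
        by (simp add: c_def inner_add_left inner_add_right power2_eq_square algebra_simps)
      then show ?thesis using B_nonneg by metis
    qed
    \<comment> \<open>The linear term dominates: \<open>|t * c| \<le> B m \<bullet> B m\<close>, and \<open>t < 0\<close>.\<close>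
    define t where "t = - (B m \<bullet> B m) / (\<bar>c\<bar> + 1)"
    have t: "t < 0" using pos by (simp add: t_def divide_neg_pos)
    have "\<bar>t\<bar> * (\<bar>c\<bar> + 1) = B m \<bullet> B m" using pos by (simp add: t_def abs_if)
    then have "\<bar>t\<bar> * \<bar>c\<bar> \<le> B m \<bullet> B m" by (simp add: distrib_left)
    then have "\<bar>t * c\<bar> \<le> B m \<bullet> B m" by (simp add: abs_mult)
    then have "0 < 2 * (B m \<bullet> B m) + t * c" using pos by linarith
    then have "t * (2 * (B m \<bullet> B m) + t * c) < 0" using t by (simp add: mult_neg_pos)
    then show False using quad[of t] by (simp add: power2_eq_square algebra_simps)
  qed
  then have "eigenvalue_of A l"
    unfolding eigenvalue_of_def using m(1) by (intro exI[of _ m]) (auto simp: B_def)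
  then have "smallest_eigenvalue A \<le> l"
    unfolding smallest_eigenvalue_def
    using finite_eigenvalues_of_symmetric[OF sym] by (intro Min_le) auto
  then have "smallest_eigenvalue A * (v \<bullet> v) \<le> l * (v \<bullet> v)" by (intro mult_right_mono) auto
  also have "\<dots> \<le> v \<bullet> (A *v v)" using B_nonneg[of v] by (simp add: B_def inner_diff_right)
  finally show ?thesis .
qed

section \<open>Stacked vectors, block matrices and Jacobians\<close>

lemma uminus_matrix_mult_vec:
  fixes A :: "real^'n^'m"
  shows "(- A) *v v = - (A *v v)"
  by (simp add: vec_eq_iff matrix_vector_mult_def sum_negf)

lemma matrix_inv_mult_left:
  fixes A :: "real^'n^'n"
  assumes "invertible A"
  shows "matrix_inv A ** A = mat 1"
  using someI_ex[OF assms[unfolded invertible_def]] unfolding matrix_inv_def by blast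

lemma stack_nth [simp]: "stack u v $ Inl i = u $ i" "stack u v $ Inr j = v $ j"
  by (simp_all add: stack_def)

lemma vec_sum_eq_iff: "u = v \<longleftrightarrow> (\<forall>i. u $ Inl i = v $ Inl i) \<and> (\<forall>j. u $ Inr j = v $ Inr j)"
  by (auto simp: vec_eq_iff) (metis sum.exhaust)

lemma stack_cases:
  obtains p q where "z = stack p q"
proof
  show "z = stack (\<chi> i. z $ Inl i) (\<chi> j. z $ Inr j)" by (simp add: vec_sum_eq_iff)
qed

lemma stack_eq_0_iff: "stack p q = 0 \<longleftrightarrow> p = 0 \<and> q = 0"
  by (auto simp: vec_sum_eq_iff vec_eq_iff)

lemma bounded_linear_stack:
  fixes f :: "'a::real_normed_vector \<Rightarrow> real^'p" and g :: "'a \<Rightarrow> real^'q"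
  assumes f: "bounded_linear f" and g: "bounded_linear g"
  shows "bounded_linear (\<lambda>x. stack (f x) (g x))"
proof -
  have "linear (\<lambda>z :: (real^'p) \<times> (real^'q). stack (fst z) (snd z))"
    by (rule linearI) (auto simp: vec_sum_eq_iff)
  then have "bounded_linear (\<lambda>z :: (real^'p) \<times> (real^'q). stack (fst z) (snd z))"
    by (simp add: linear_conv_bounded_linear)
  from bounded_linear_compose[OF this bounded_linear_Pair[OF f g]] show ?thesis by simp
qed

lemmas bounded_linear_stack_pair = bounded_linear_stack[OF bounded_linear_fst bounded_linear_snd]

lemma has_derivative_stack:
  fixes f :: "'a::real_normed_vector \<Rightarrow> real^'p" and g :: "'a \<Rightarrow> real^'q"
  assumes "(f has_derivative f') (at x)" "(g has_derivative g') (at x)"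
  shows "((\<lambda>x. stack (f x) (g x)) has_derivative (\<lambda>h. stack (f' h) (g' h))) (at x)"
  using bounded_linear.has_derivative[OF bounded_linear_stack_pair has_derivative_Pair[OF assms]] by simp

lemma has_derivative_upper_block:
  fixes f :: "'a::real_normed_vector \<Rightarrow> real^'p" and g :: "'a \<Rightarrow> real^'q"
  assumes "((\<lambda>x. stack (f x) (g x)) has_derivative D) F"
  shows "(f has_derivative (\<lambda>h. \<chi> i. D h $ Inl i)) F"
proof -
  have "linear (\<lambda>z :: real^('p + 'q). \<chi> i. z $ Inl i)"
    by (rule linearI) (auto simp: vec_eq_iff)
  then have "bounded_linear (\<lambda>z :: real^('p + 'q). \<chi> i. z $ Inl i)"
    by (simp add: linear_conv_bounded_linear)
  from bounded_linear.has_derivative[OF this assms] show ?thesis by simp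
qed

lemma tendsto_stack:
  fixes f :: "'a \<Rightarrow> real^'p" and g :: "'a \<Rightarrow> real^'q"
  assumes "(f \<longlongrightarrow> p) F" "(g \<longlongrightarrow> q) F"
  shows "((\<lambda>x. stack (f x) (g x)) \<longlongrightarrow> stack p q) F"
  using bounded_linear.tendsto[OF bounded_linear_stack_pair tendsto_Pair[OF assms]] by simp

lemma sum_UNIV_sum_type: "(\<Sum>i\<in>(UNIV :: ('p::finite + 'q::finite) set). g i) = (\<Sum>i\<in>UNIV. g (Inl i)) + (\<Sum>j\<in>UNIV. g (Inr j))"
  by (subst UNIV_Plus_UNIV[symmetric]) (simp add: sum.Plus o_def del: UNIV_Plus_UNIV)

lemma stack_mult_vec: "stack P Q *v h = stack (P *v h) (Q *v h)"
  by (simp add: vec_sum_eq_iff matrix_vector_mult_def)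

lemma block_matrix_mult_stack:
  "block_matrix A B C D *v stack p q = stack (A *v p + B *v q) (C *v p + D *v q)"
  by (simp add: vec_sum_eq_iff matrix_vector_mult_def block_matrix_def sum_UNIV_sum_type)

lemma jacobian_mult_vec:
  fixes g :: "real^'m \<Rightarrow> real^'n"
  assumes "(g has_derivative D) (at x)"
  shows "jacobian g (at x) *v h = D h"
proof -
  have "(g has_derivative (\<lambda>h. jacobian g (at x) *v h)) (at x)"
    using assms by (simp add: jacobian_works[symmetric] differentiable_def) blast
  from has_derivative_unique[OF this assms] show ?thesis by metis
qed

lemma tendsto_matrix_pointwise:
  fixes A :: "'a \<Rightarrow> real^'m^'n"
  assumes "\<And>h. ((\<lambda>k. A k *v h) \<longlongrightarrow> B *v h) F"
  shows "(A \<longlongrightarrow> B) F"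
proof (intro vec_tendstoI)
  fix i j
  have "((\<lambda>k. (A k *v axis j 1) $ i) \<longlongrightarrow> (B *v axis j 1) $ i) F"
    by (intro tendsto_vec_nth assms)
  then show "((\<lambda>k. A k $ i $ j) \<longlongrightarrow> B $ i $ j) F"
    by (simp add: matrix_vector_mult_basis column_def)
qed

lemma hessians_mult_vec:
  fixes f :: "real^'n \<Rightarrow> real^'m \<Rightarrow> real"
  assumes "((\<lambda>(u, \<theta>). grad_x f u \<theta>) has_derivative K) (at (u, \<theta>))"
  shows "hess_xx f u \<theta> *v v = K (v, 0)" and "hess_xt f u \<theta> *v h = K (0, h)"
proof -
  have "((\<lambda>w. (w, \<theta>)) has_derivative (\<lambda>v. (v, 0))) (at u)"
    "((\<lambda>t. (u, t)) has_derivative (\<lambda>h. (0, h))) (at \<theta>)"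
    by (auto intro!: derivative_eq_intros)
  from this[THEN has_derivative_compose, OF assms]
  have x: "((\<lambda>w. grad_x f w \<theta>) has_derivative (\<lambda>v. K (v, 0))) (at u)"
    and t: "((\<lambda>t. grad_x f u t) has_derivative (\<lambda>h. K (0, h))) (at \<theta>)"
    by simp_all
  show "hess_xx f u \<theta> *v v = K (v, 0)"
    unfolding hess_xx_def by (rule jacobian_mult_vec[OF x])
  show "hess_xt f u \<theta> *v h = K (0, h)"
    unfolding hess_xt_def by (rule jacobian_mult_vec[OF t])
qed

section \<open>Convergence of the derivatives\<close>

lemma seq_limit_point_of_tendsto: "s \<longlonglongrightarrow> l \<Longrightarrow> seq_limit_point s l"
  unfolding seq_limit_point_def by (intro exI[of _ id]) (auto simp: strict_mono_def)

text \<open>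
  The stability margin against oscillation, for one value \<open>H\<close> of the Hessian applied to \<open>v\<close>. If
  \<open>b < 1\<close>, the eigenvalue condition \<open>2 (b - a) - 1 < (1 + 2 b) \<eta>\<close> is exactly positivity of
  \<open>1 + 2 (a - b) + (1 + 2 b) \<eta>\<close>, the value of \<open>1 + D + T\<close> on the lowest eigenspace of \<open>1 - \<gamma> H\<close>. If
  \<open>b = 1\<close>, the bound \<open>3 \<gamma> L < 2\<close> gives it directly, as the Hessian is at most \<open>L\<close>.
\<close>
lemma oscillation_bound:
  assumes a: "a \<in> {0..<1}" and b: "b \<in> {0..1}" and \<gamma>: "0 < \<gamma>" and L: "0 < L"
    and b_one: "b = 1 \<Longrightarrow> \<gamma> * L < 2 / 3"
    and C2: "b < 1 \<Longrightarrow> (2 * (b - a) - 1) / (1 + 2 * b) < \<eta>"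
  obtains \<kappa> where "0 < \<kappa>"
    and "\<And>v H :: 'a::real_inner. v \<bullet> H \<le> L * (v \<bullet> v) \<Longrightarrow> \<eta> * (v \<bullet> v) \<le> v \<bullet> v - \<gamma> * (v \<bullet> H) \<Longrightarrow>
      \<gamma> * (1 + 2 * b) * (v \<bullet> H) \<le> (2 + 2 * a - \<kappa>) * (v \<bullet> v)"
proof (cases "b = 1")
  case True
  show thesis
  proof (rule that[of "2 - 3 * (\<gamma> * L)"])
    show "0 < 2 - 3 * (\<gamma> * L)" using b_one[OF True] by simp
    fix v H :: 'a assume "v \<bullet> H \<le> L * (v \<bullet> v)"
    then have "3 * \<gamma> * (v \<bullet> H) \<le> 3 * \<gamma> * (L * (v \<bullet> v))" using \<gamma> by (intro mult_left_mono) auto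
    moreover have "0 \<le> a * (v \<bullet> v)" using a by simp
    ultimately show "\<gamma> * (1 + 2 * b) * (v \<bullet> H) \<le> (2 + 2 * a - (2 - 3 * (\<gamma> * L))) * (v \<bullet> v)"
      by (simp add: True algebra_simps)
  qed
next
  case False
  show thesis
  proof (rule that[of "(1 + 2 * b) * \<eta> - (2 * (b - a) - 1)"])
    show "0 < (1 + 2 * b) * \<eta> - (2 * (b - a) - 1)"
      using C2 False b by (simp add: pos_divide_less_eq mult.commute)
    fix v H :: 'a assume "\<eta> * (v \<bullet> v) \<le> v \<bullet> v - \<gamma> * (v \<bullet> H)"
    then have "(1 + 2 * b) * (\<eta> * (v \<bullet> v)) \<le> (1 + 2 * b) * (v \<bullet> v - \<gamma> * (v \<bullet> H))"
      using b by (intro mult_left_mono) auto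
    then show "\<gamma> * (1 + 2 * b) * (v \<bullet> H) \<le> (2 + 2 * a - ((1 + 2 * b) * \<eta> - (2 * (b - a) - 1))) * (v \<bullet> v)"
      by (simp add: algebra_simps)
  qed
qed

theorem theorem3p6:
  fixes \<Theta> :: "(real^'m) set"
    and f :: "real^'n \<Rightarrow> real^'m \<Rightarrow> real"
    and L abar bbar a b \<gamma> :: real
    and ak bk \<gamma>k :: "nat \<Rightarrow> real"
    and x :: "nat \<Rightarrow> real^'m \<Rightarrow> real^'n"
  defines "xstar \<equiv> \<lambda>\<theta>. the_minimizer (\<lambda>u. f u \<theta>)"
    and "X \<equiv> \<lambda>k \<theta>. stack (x k \<theta>) (x (k - 1) \<theta>)"
  defines "Xstar \<equiv> \<lambda>\<theta>. stack (xstar \<theta>) (xstar \<theta>)"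
    and "H \<equiv> \<lambda>\<theta>. hess_xx f (xstar \<theta>) \<theta>"
    and "J \<equiv> \<lambda>\<theta>. hess_xt f (xstar \<theta>) \<theta>"
  defines "M \<equiv> \<lambda>\<theta>. block_matrix
       (- (a *\<^sub>R mat 1) + (\<gamma> * (1 + b)) *\<^sub>R H \<theta>)   (a *\<^sub>R mat 1 - (\<gamma> * b) *\<^sub>R H \<theta>)
       (- mat 1)                                (mat 1)"
  assumes open_\<Theta>: "open \<Theta>"
    and A1: "C2_on (UNIV \<times> \<Theta>) (\<lambda>(u, \<theta>). f u \<theta>)"
    and L_pos: "0 < L"
    and A2_x: "\<And>\<theta>. \<theta> \<in> \<Theta> \<Longrightarrow> L-lipschitz_on UNIV (\<lambda>u. grad_x f u \<theta>)"
    and A2_\<theta>: "\<And>u. L-lipschitz_on \<Theta> (\<lambda>\<theta>. grad_x f u \<theta>)"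
    and A3: "\<And>\<theta>. \<theta> \<in> \<Theta> \<Longrightarrow> level_bounded (\<lambda>u. f u \<theta>)"
    and str_convex: "\<And>\<theta>. \<theta> \<in> \<Theta> \<Longrightarrow> strongly_convex (\<lambda>u. f u \<theta>)"
    and ak_range: "\<And>k. ak k \<in> {0..abar}" "abar \<le> 1"
    and bk_range: "\<And>k. bk k \<in> {0..bbar}" "bbar \<le> 1"
    and \<gamma>k_range: "\<And>k. \<gamma>k k \<in> {0<..<2 / L}"
    and iteration: "\<And>\<theta>. \<theta> \<in> \<Theta> \<Longrightarrow>
          inertial_iteration (\<lambda>u. grad_x f u \<theta>) ak bk \<gamma>k (\<lambda>k. x k \<theta>)"
    and B: "condition_B L ak bk \<gamma>k"
    and C1: "a \<in> {0..1}" "b \<in> {0..1}" "\<gamma> \<in> {0<..<2 / L}"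
            "ak \<longlonglongrightarrow> a" "bk \<longlonglongrightarrow> b" "\<gamma>k \<longlonglongrightarrow> \<gamma>"
    and C2: "\<And>\<theta>. \<theta> \<in> \<Theta> \<Longrightarrow>
          condition_C2 ak bk (smallest_eigenvalue (mat 1 - \<gamma> *\<^sub>R H \<theta>))"
    and X0: "C1_on \<Theta> (X 0)"
  shows "(\<forall>\<theta>\<in>\<Theta>. (\<forall>k. X k differentiable (at \<theta>)) \<and> Xstar differentiable (at \<theta>) \<and>
            (\<lambda>k. jacobian (X k) (at \<theta>)) \<longlonglongrightarrow> jacobian Xstar (at \<theta>)) \<and>
         (\<forall>\<theta>\<in>\<Theta>. invertible (M \<theta>) \<and>
            jacobian Xstar (at \<theta>) = matrix_inv (M \<theta>) ** stack (- (\<gamma> *\<^sub>R J \<theta>)) 0)"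
proof -
  obtain F' :: "(real^'n) \<times> (real^'m) \<Rightarrow> ((real^'n) \<times> (real^'m)) \<Rightarrow>\<^sub>L (real^'n)" where
    grad: "\<And>u \<theta>. \<theta> \<in> \<Theta> \<Longrightarrow> GDERIV (\<lambda>u. f u \<theta>) u :> grad_x f u \<theta>"
    and F': "\<And>u \<theta>. \<theta> \<in> \<Theta> \<Longrightarrow> ((\<lambda>(u, \<theta>). grad_x f u \<theta>) has_derivative F' (u, \<theta>)) (at (u, \<theta>))"
    and F'_cont: "continuous_on (UNIV \<times> \<Theta>) F'"
    using C2_on_imp_C1_gradient[OF A1 open_\<Theta>] by blast
  have \<gamma>: "0 < \<gamma>" "\<gamma> * L < 2" using C1(3) L_pos by (auto simp: field_simps)
  have bk0: "0 \<le> bk k" for k using bk_range(1)[of k] by simp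
  have ck: "0 \<le> \<gamma>k k * L / 2" "\<gamma>k k * L / 2 \<le> 1" for k
    using \<gamma>k_range[of k] L_pos by (auto simp: field_simps)
  have b01: "0 \<le> b" "b \<le> 1" using C1(2) by auto
  have \<gamma>L: "0 \<le> \<gamma> * L" using \<gamma> L_pos by simp
  note limits = condition_B_limits[OF B bk0 ck C1(4-6) b01 \<gamma>L \<gamma>(2)]
  \<comment> \<open>The analytic content at one parameter, in terms of derivatives as linear maps; the claims about
      Jacobians follow by linear algebra.\<close>
  have core: "\<exists>S D. (xstar has_derivative S) (at \<theta>) \<and> (\<forall>k. (x k has_derivative D k) (at \<theta>)) \<and>
      (\<forall>h. (\<lambda>k. D k h) \<longlonglongrightarrow> S h) \<and> (\<forall>h. H \<theta> *v S h = - (J \<theta> *v h)) \<and>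
      (\<forall>v. H \<theta> *v v = 0 \<longrightarrow> v = 0)" if \<theta>: "\<theta> \<in> \<Theta>" for \<theta>
  proof -
    define K where "K = F' (xstar \<theta>, \<theta>)"
    obtain \<mu> where conv: "strongly_convex_with \<mu> (\<lambda>u. f u \<theta>)"
      using str_convex[OF \<theta>] by (auto simp: strongly_convex_def strongly_convex_with_def)
    have \<mu>: "0 < \<mu>" using conv by (simp add: strongly_convex_with_def)
    note mono = strongly_convex_monotone[OF grad[OF \<theta>] conv]
    have zero: "grad_x f (xstar t) t = 0" if "t \<in> \<Theta>" for t
    proof -
      obtain \<nu> where "strongly_convex_with \<nu> (\<lambda>u. f u t)"
        using str_convex[OF \<open>t \<in> \<Theta>\<close>] by (auto simp: strongly_convex_def strongly_convex_with_def)
      from the_minimizer_of_strongly_convex[OF grad[OF that] this A3[OF that]]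
      show ?thesis by (simp add: xstar_def)
    qed
    have K_der: "((\<lambda>(u, \<theta>). grad_x f u \<theta>) has_derivative K) (at (xstar \<theta>, \<theta>))"
      unfolding K_def by (rule F'[OF \<theta>])
    have HK: "H \<theta> *v v = K (v, 0)" and JK: "J \<theta> *v h = K (0, h)" for v h
      unfolding H_def J_def by (rule hessians_mult_vec[OF K_der])+
    have K_der_x: "((\<lambda>u. grad_x f u \<theta>) has_derivative (\<lambda>v. K (v, 0))) (at (xstar \<theta>))"
    proof -
      have "((\<lambda>u. (u, \<theta>)) has_derivative (\<lambda>v. (v, 0))) (at (xstar \<theta>))"
        by (auto intro!: derivative_eq_intros)
      from has_derivative_compose[OF this K_der] show ?thesis by simp
    qed
    have K_sym: "K (u, 0) \<bullet> v = u \<bullet> K (v, 0)" for u v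
      by (rule derivative_of_gradient_symmetric[OF grad[OF \<theta>] K_der_x])
    have K_lower: "\<mu> * (v \<bullet> v) \<le> v \<bullet> K (v, 0)" for v
      by (rule derivative_of_gradient_bounds(1)[OF K_der_x mono(1)])
    have K_upper: "v \<bullet> K (v, 0) \<le> L * (v \<bullet> v)" for v
      by (rule derivative_of_gradient_bounds(2)[OF K_der_x A2_x[OF \<theta>]])
    \<comment> \<open>Injectivity of the Hessian, in the quantitative form that the derivative of the minimizer needs.\<close>
    have coercive: "\<mu> * norm v \<le> norm (K (v, 0))" for v
    proof -
      have "\<mu> * (norm v)\<^sup>2 \<le> norm v * norm (K (v, 0))"
        using K_lower[of v] norm_cauchy_schwarz[of v "K (v, 0)"] by (simp add: dot_square_norm)
      then show ?thesis by (cases "v = 0") (auto simp: power2_eq_square)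
    qed
    obtain S where S: "(xstar has_derivative S) (at \<theta>)" and KS: "\<And>h. K (S h, h) = 0"
    proof (rule parametrized_zero_has_derivative[where s = xstar and L = L and F = "\<lambda>(u, \<theta>). grad_x f u \<theta>"
          and K = K, OF open_\<Theta> \<theta> _ K_der \<mu> _ _ coercive])
      show "(case (xstar t, t) of (u, x) \<Rightarrow> grad_x f u x) = 0" if "t \<in> \<Theta>" for t
        using zero[OF that] by simp
      show "\<mu> * norm (y - z) \<le> norm ((case (y, \<theta>) of (u, x) \<Rightarrow> grad_x f u x) - (case (z, \<theta>) of (u, x) \<Rightarrow> grad_x f u x))" for y z
        using mono(2) by simp
      show "norm ((case (u, t) of (u, x) \<Rightarrow> grad_x f u x) - (case (u, \<theta>) of (u, x) \<Rightarrow> grad_x f u x)) \<le> L * norm (t - \<theta>)"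
        if "t \<in> \<Theta>" for u t
        using lipschitz_onD[OF A2_\<theta> that \<theta>] by (simp add: dist_norm)
    qed (rule that)
    have x_lim: "(\<lambda>k. x k \<theta>) \<longlonglongrightarrow> xstar \<theta>"
      by (rule inertial_iterates_converge[OF grad[OF \<theta>] conv A2_x[OF \<theta>] L_pos zero[OF \<theta>]
          iteration[OF \<theta>] bk0 \<gamma>k_range B C1(4-6) \<gamma>(1)])
    have "x 0 differentiable (at \<theta>)"
    proof -
      obtain E where "(X 0 has_derivative E) (at \<theta>)" using X0 \<theta> by (auto simp: C1_on_def)
      from has_derivative_upper_block[OF this[unfolded X_def]]
      show ?thesis by (auto simp: differentiable_def)
    qed
    then obtain D where D: "\<And>k. (x k has_derivative D k) (at \<theta>)"
      and D_step: "\<And>k h. D (Suc k) h = D k h + ak k *\<^sub>R (D k h - D (k - 1) h)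
        - \<gamma>k k *\<^sub>R F' (x k \<theta> + bk k *\<^sub>R (x k \<theta> - x (k - 1) \<theta>), \<theta>) (D k h + bk k *\<^sub>R (D k h - D (k - 1) h), h)"
      using inertial_iterates_has_derivative[OF open_\<Theta> \<theta>, of "\<lambda>(u, \<theta>). grad_x f u \<theta>" ak bk \<gamma>k x
          "\<lambda>u. F' (u, \<theta>)"] iteration F'[OF \<theta>] by auto
    define Kk where "Kk k = F' (x k \<theta> + bk k *\<^sub>R (x k \<theta> - x (k - 1) \<theta>), \<theta>)" for k
    have Kk: "Kk \<longlonglongrightarrow> K"
    proof -
      have "(\<lambda>k. x (k - 1) \<theta>) \<longlonglongrightarrow> xstar \<theta>"
        by (rule LIMSEQ_imp_Suc) (simp add: x_lim)
      then have "(\<lambda>k. (x k \<theta> + bk k *\<^sub>R (x k \<theta> - x (k - 1) \<theta>), \<theta>)) \<longlonglongrightarrow> (xstar \<theta> + b *\<^sub>R (xstar \<theta> - xstar \<theta>), \<theta>)"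
        by (intro tendsto_intros x_lim C1)
      then show ?thesis
        unfolding Kk_def K_def using F'_cont \<theta>
        by (intro continuous_on_tendsto_compose[OF F'_cont]) auto
    qed
    let ?\<eta> = "smallest_eigenvalue (mat 1 - \<gamma> *\<^sub>R H \<theta>)"
    have G: "(mat 1 - \<gamma> *\<^sub>R H \<theta>) *v v = v - \<gamma> *\<^sub>R K (v, 0)" for v
      by (simp add: matrix_vector_mult_diff_rdistrib scaleR_matrix_vector_assoc[symmetric] HK)
    have rayleigh: "?\<eta> * (v \<bullet> v) \<le> v \<bullet> v - \<gamma> * (v \<bullet> K (v, 0))" for v
    proof -
      have "?\<eta> * (v \<bullet> v) \<le> v \<bullet> ((mat 1 - \<gamma> *\<^sub>R H \<theta>) *v v)"
        by (rule smallest_eigenvalue_le_rayleigh) (simp only: G inner_diff_left inner_diff_right inner_scaleR_left inner_scaleR_right K_sym)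
      then show ?thesis by (simp only: G inner_diff_right inner_scaleR_right)
    qed
    obtain \<kappa> where \<kappa>: "0 < \<kappa>"
      "\<And>v. \<gamma> * (1 + 2 * b) * (v \<bullet> K (v, 0)) \<le> (2 + 2 * a - \<kappa>) * (v \<bullet> v)"
    proof (rule oscillation_bound[of a b \<gamma> L ?\<eta>, where 'a = "real^'n"])
      show "a \<in> {0..<1}" using C1(1) limits(1) by simp
      show "(2 * (b - a) - 1) / (1 + 2 * b) < ?\<eta>" if "b < 1"
        using C2[OF \<theta>, unfolded condition_C2_def, rule_format, of a b]
          seq_limit_point_of_tendsto[OF C1(4)] seq_limit_point_of_tendsto[OF C1(5)]
          limits(1) that C1(1,2) by simp
      fix \<kappa> assume \<kappa>: "0 < \<kappa>" and bound: "\<And>v H :: real^'n. v \<bullet> H \<le> L * (v \<bullet> v) \<Longrightarrow>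
        ?\<eta> * (v \<bullet> v) \<le> v \<bullet> v - \<gamma> * (v \<bullet> H) \<Longrightarrow> \<gamma> * (1 + 2 * b) * (v \<bullet> H) \<le> (2 + 2 * a - \<kappa>) * (v \<bullet> v)"
      show thesis by (rule that[OF \<kappa> bound[OF K_upper rayleigh]])
    qed (use C1(2) \<gamma>(1) L_pos limits(2) in auto)
    have D_lim: "(\<lambda>k. D k h) \<longlonglongrightarrow> S h" for h
      by (rule linearized_inertial_iteration_converges[OF D_step[folded Kk_def] C1(4-6) Kk KS K_sym
          \<mu> K_lower limits(1) b01(1) \<gamma>(1) \<kappa>])
    have "H \<theta> *v S h = - (J \<theta> *v h)" for h
    proof -
      have "K (S h, 0) + K (0, h) = K (S h, h)" by (simp flip: blinfun.add_right)
      then show ?thesis using KS[of h] by (simp add: HK JK eq_neg_iff_add_eq_0)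
    qed
    moreover have "v = 0" if "H \<theta> *v v = 0" for v
      using coercive[of v] that \<mu> by (simp add: HK mult_le_0_iff)
    ultimately show ?thesis using S D D_lim by blast
  qed
  have M_mult: "M \<theta> *v stack p q = stack ((\<gamma> * (1 + b)) *\<^sub>R (H \<theta> *v p) - a *\<^sub>R p
      + (a *\<^sub>R q - (\<gamma> * b) *\<^sub>R (H \<theta> *v q))) (q - p)"
    for \<theta> p q
    by (simp add: M_def block_matrix_mult_stack matrix_vector_mult_add_rdistrib
        matrix_vector_mult_diff_rdistrib scaleR_matrix_vector_assoc[symmetric] uminus_matrix_mult_vec)
  show ?thesis
  proof (intro conjI ballI allI)
    fix \<theta> assume \<theta>: "\<theta> \<in> \<Theta>"
    obtain S D where S: "(xstar has_derivative S) (at \<theta>)"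
      and D: "\<And>k. (x k has_derivative D k) (at \<theta>)" and D_lim: "\<And>h. (\<lambda>k. D k h) \<longlonglongrightarrow> S h"
      and HS: "\<And>h. H \<theta> *v S h = - (J \<theta> *v h)" and H_inj: "\<And>v. H \<theta> *v v = 0 \<Longrightarrow> v = 0"
      using core[OF \<theta>] by blast
    have X_der: "(X k has_derivative (\<lambda>h. stack (D k h) (D (k - 1) h))) (at \<theta>)" for k
      unfolding X_def by (rule has_derivative_stack[OF D D])
    have Xstar_der: "(Xstar has_derivative (\<lambda>h. stack (S h) (S h))) (at \<theta>)"
      unfolding Xstar_def by (rule has_derivative_stack[OF S S])
    show "X k differentiable (at \<theta>)" for k using X_der[of k] by (auto simp: differentiable_def)
    show "Xstar differentiable (at \<theta>)" using Xstar_der by (auto simp: differentiable_def)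
    show "(\<lambda>k. jacobian (X k) (at \<theta>)) \<longlonglongrightarrow> jacobian Xstar (at \<theta>)"
    proof (rule tendsto_matrix_pointwise)
      fix h
      have "(\<lambda>k. D (k - 1) h) \<longlonglongrightarrow> S h" by (rule LIMSEQ_imp_Suc) (simp add: D_lim)
      then show "(\<lambda>k. jacobian (X k) (at \<theta>) *v h) \<longlonglongrightarrow> jacobian Xstar (at \<theta>) *v h"
        unfolding jacobian_mult_vec[OF X_der] jacobian_mult_vec[OF Xstar_der]
        by (intro tendsto_stack D_lim)
    qed
    have "z = 0" if "M \<theta> *v z = 0" for z
    proof -
      obtain p q where z: "z = stack p q" by (rule stack_cases)
      from that have "q = p" and "(\<gamma> * (1 + b)) *\<^sub>R (H \<theta> *v p) - a *\<^sub>R p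
          + (a *\<^sub>R q - (\<gamma> * b) *\<^sub>R (H \<theta> *v q)) = 0"
        by (auto simp: z M_mult stack_eq_0_iff)
      then have "\<gamma> *\<^sub>R (H \<theta> *v p) = 0" by (simp add: algebra_simps flip: scaleR_diff_left)
      then have "p = 0" using \<gamma>(1) H_inj by simp
      then show ?thesis using \<open>q = p\<close> by (simp add: z stack_eq_0_iff)
    qed
    then show inv: "invertible (M \<theta>)"
      by (simp add: invertible_left_inverse matrix_left_invertible_ker)
    have "M \<theta> ** jacobian Xstar (at \<theta>) = stack (- (\<gamma> *\<^sub>R J \<theta>)) 0"
      unfolding matrix_eq
    proof
      fix h
      have "M \<theta> *v stack (S h) (S h) = stack (\<gamma> *\<^sub>R (H \<theta> *v S h)) 0"
        by (simp add: M_mult algebra_simps flip: scaleR_diff_left)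
      then show "(M \<theta> ** jacobian Xstar (at \<theta>)) *v h = stack (- (\<gamma> *\<^sub>R J \<theta>)) 0 *v h"
        by (simp add: matrix_vector_mul_assoc[symmetric] jacobian_mult_vec[OF Xstar_der]
            stack_mult_vec HS uminus_matrix_mult_vec scaleR_matrix_vector_assoc[symmetric])
    qed
    moreover have "matrix_inv (M \<theta>) ** M \<theta> = mat 1" using inv by (rule matrix_inv_mult_left)
    ultimately show "jacobian Xstar (at \<theta>) = matrix_inv (M \<theta>) ** stack (- (\<gamma> *\<^sub>R J \<theta>)) 0"
      by (metis matrix_mul_assoc matrix_mul_lid)
  qed
qed

end
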